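(* There is a tableau for $\rho_1$ if and only if $\rho_1$ is $\rho_0$-satisfiable.
   Context: Monotone $\mu$-calculus: formulae in negation normal form over atoms $\mathsf{P}$ (closed under duals $\overline{p}$), atomic programs $\mathsf{A}$, fixpoint variables; grammar $\bot\mid\top\mid p\mid\psi\wedge\phi\mid\psi\vee\phi\mid\langle a\rangle\psi\mid[a]\psi\mid X\mid\eta X.\psi$ with $\eta\in\{\mu,\nu\}$. Semantics over neighbourhood models $(W,N,I)$ with $N:\mathsf{A}\times W\to 2^{(2^W)}$: $\langle a\rangle\psi$ holds at $w$ iff some $S\in N(a,w)$ has $S\subseteq[\![\psi]\!]$; $[a]\psi$ holds at $w$ iff every $S\in N(a,w)$ meets $[\![\psi]\!]$; $\mu,\nu$ are least/greatest fixpoints. $\rho_1,\rho_0$ are fixed closed, clean, irredundant, guarded, alternation-free formulae; $\rho_1$ is $\rho_0$-satisfiable if it is satisfiable in a model where $\rho_0$ holds at every state. $\mathsf{cl}$ is the union of the Fischer–Ladner closures of $\rho_1$ and $\rho_0$ (closed under subformulae and fixpoint unfolding $\eta X.\phi\mapsto\phi[\eta X.\phi/X]$), $\mathsf{dfr}\subseteq\mathsf{cl}$ is the set of deferrals (closures $\chi$ of subformulae with a free least fixpoint variable, with that variable replaced by its binding formula). Tableau rules (premise / conclusions): $(\bot)$: $\Gamma,\bot$ / (no conclusions); (clash): $\Gamma,p,\overline{p}$ / (no conclusions); $(\wedge)$: $\Gamma,\phi_1\wedge\phi_2$ / $\Gamma,\phi_1,\phi_2$; $(\vee)$: $\Gamma,\phi_1\vee\phi_2$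 / $\Gamma,\phi_1$ and $\Gamma,\phi_2$; $(\langle a\rangle)$: $\Gamma,\langle a\rangle\phi_1,[a]\phi_2$ / $\phi_1,\phi_2,\rho_0$; $(\eta)$: $\Gamma,\eta X.\phi$ / $\Gamma,\phi[\eta X.\phi/X]$. Formal states: sets $\Gamma\subseteq\mathsf{cl}$ not containing $\bot$, not containing both $p$ and $\overline p$, and with no formula having top-level $\wedge,\vee,\eta X$. A pre-tableau is a finite graph $(W,L)$ with labels $l:W\to\mathcal{P}(\mathsf{cl})$ such that for each node labelled by a formal state $\Gamma$ and each rule application to $\Gamma$ there is an edge to a node labelled with one of its conclusions, and each node not labelled by a state has exactly one successor, labelled with a conclusion of some non-modal rule application to its label. Deferrals are tracked along branches via a tracking function $\delta$ (following a deferral through the rule applied to it: to its deferral conjuncts, to the chosen disjunct if a deferral, to the unfolding of $\mu X$, to the argument of the modal literal used in the modal rule; unchanged otherwise); a trace is a sequence $\phi_0,\phi_1,\ldots$ with $\phi_{i+1}\in\delta(\phi_i,\text{rule application } i)$. A tableau is a finite pre-tableau in which all traces are finite; it is a tableau for $\rho_1$ if some node label contains $\rho_1$.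
   Formalization: A tableau for ρ1 is here required to have a node whose label contains both ρ1 and ρ0, not just ρ1; with ρ1 alone the claim fails for ρ1 = p, ρ0 = p̄, where the single node labelled {p} is a tableau although p is not p̄-satisfiable. *)

theory Defs
  imports Main
begin

section \<open>Formulae in negation normal form\<close>

datatype 'p atom = Pos 'p | Neg 'p

fun dual :: "'p atom \<Rightarrow> 'p atom" where
  "dual (Pos p) = Neg p"
| "dual (Neg p) = Pos p"

datatype fp = Mu | Nu

datatype ('p, 'a, 'v) fm =
    Bot
  | Top
  | Atom "'p atom"
  | And "('p, 'a, 'v) fm" "('p, 'a, 'v) fm"
  | Or "('p, 'a, 'v) fm" "('p, 'a, 'v) fm"
  | Dia 'a "('p, 'a, 'v) fm"
  | Box 'a "('p, 'a, 'v) fm"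
  | Var 'v
  | Fix fp 'v "('p, 'a, 'v) fm"

primrec fv :: "('p, 'a, 'v) fm \<Rightarrow> 'v set" where
  "fv Bot = {}"
| "fv Top = {}"
| "fv (Atom p) = {}"
| "fv (And \<phi> \<psi>) = fv \<phi> \<union> fv \<psi>"
| "fv (Or \<phi> \<psi>) = fv \<phi> \<union> fv \<psi>"
| "fv (Dia a \<phi>) = fv \<phi>"
| "fv (Box a \<phi>) = fv \<phi>"
| "fv (Var X) = {X}"
| "fv (Fix \<eta> X \<phi>) = fv \<phi> - {X}"

(* Free variables having an occurrence outside the scope of all modal operators. *)
primrec unguarded_fv :: "('p, 'a, 'v) fm \<Rightarrow> 'v set" where
  "unguarded_fv Bot = {}"
| "unguarded_fv Top = {}"
| "unguarded_fv (Atom p) = {}"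
| "unguarded_fv (And \<phi> \<psi>) = unguarded_fv \<phi> \<union> unguarded_fv \<psi>"
| "unguarded_fv (Or \<phi> \<psi>) = unguarded_fv \<phi> \<union> unguarded_fv \<psi>"
| "unguarded_fv (Dia a \<phi>) = {}"
| "unguarded_fv (Box a \<phi>) = {}"
| "unguarded_fv (Var X) = {X}"
| "unguarded_fv (Fix \<eta> X \<phi>) = unguarded_fv \<phi> - {X}"

(* The variables of all binder occurrences, with multiplicity. *)
primrec binders :: "('p, 'a, 'v) fm \<Rightarrow> 'v list" where
  "binders Bot = []"
| "binders Top = []"
| "binders (Atom p) = []"
| "binders (And \<phi> \<psi>) = binders \<phi> @ binders \<psi>"
| "binders (Or \<phi> \<psi>) = binders \<phi> @ binders \<psi>"
| "binders (Dia a \<phi>) = binders \<phi>"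
| "binders (Box a \<phi>) = binders \<phi>"
| "binders (Var X) = []"
| "binders (Fix \<eta> X \<phi>) = X # binders \<phi>"

primrec subfms :: "('p, 'a, 'v) fm \<Rightarrow> ('p, 'a, 'v) fm set" where
  "subfms Bot = {Bot}"
| "subfms Top = {Top}"
| "subfms (Atom p) = {Atom p}"
| "subfms (And \<phi> \<psi>) = insert (And \<phi> \<psi>) (subfms \<phi> \<union> subfms \<psi>)"
| "subfms (Or \<phi> \<psi>) = insert (Or \<phi> \<psi>) (subfms \<phi> \<union> subfms \<psi>)"
| "subfms (Dia a \<phi>) = insert (Dia a \<phi>) (subfms \<phi>)"
| "subfms (Box a \<phi>) = insert (Box a \<phi>) (subfms \<phi>)"
| "subfms (Var X) = {Var X}"
| "subfms (Fix \<eta> X \<phi>) = insert (Fix \<eta> X \<phi>) (subfms \<phi>)"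

definition closed_fm :: "('p, 'a, 'v) fm \<Rightarrow> bool" where
  "closed_fm \<phi> \<longleftrightarrow> fv \<phi> = {}"

definition clean :: "('p, 'a, 'v) fm \<Rightarrow> bool" where
  "clean \<phi> \<longleftrightarrow> distinct (binders \<phi>) \<and> fv \<phi> \<inter> set (binders \<phi>) = {}"

definition irredundant :: "('p, 'a, 'v) fm \<Rightarrow> bool" where
  "irredundant \<phi> \<longleftrightarrow> (\<forall>\<eta> X \<psi>. Fix \<eta> X \<psi> \<in> subfms \<phi> \<longrightarrow> X \<in> fv \<psi>)"

definition guarded :: "('p, 'a, 'v) fm \<Rightarrow> bool" where
  "guarded \<phi> \<longleftrightarrow> (\<forall>\<eta> X \<psi>. Fix \<eta> X \<psi> \<in> subfms \<phi> \<longrightarrow> X \<notin> unguarded_fv \<psi>)"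

definition alternation_free :: "('p, 'a, 'v) fm \<Rightarrow> bool" where
  "alternation_free \<phi> \<longleftrightarrow>
     (\<forall>\<eta> X \<psi> \<eta>' Y \<chi>. Fix \<eta> X \<psi> \<in> subfms \<phi> \<longrightarrow> Fix \<eta>' Y \<chi> \<in> subfms \<psi> \<longrightarrow>
        \<eta> \<noteq> \<eta>' \<longrightarrow> X \<notin> fv (Fix \<eta>' Y \<chi>))"

(* Simultaneous substitution. It does not rename bound variables; it is only ever used
   with \<sigma> mapping each variable either to itself or to a closed formula, so nothing is captured. *)
primrec inst :: "('v \<Rightarrow> ('p, 'a, 'v) fm) \<Rightarrow> ('p, 'a, 'v) fm \<Rightarrow> ('p, 'a, 'v) fm" where
  "inst \<sigma> Bot = Bot"
| "inst \<sigma> Top = Top"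
| "inst \<sigma> (Atom p) = Atom p"
| "inst \<sigma> (And \<phi> \<psi>) = And (inst \<sigma> \<phi>) (inst \<sigma> \<psi>)"
| "inst \<sigma> (Or \<phi> \<psi>) = Or (inst \<sigma> \<phi>) (inst \<sigma> \<psi>)"
| "inst \<sigma> (Dia a \<phi>) = Dia a (inst \<sigma> \<phi>)"
| "inst \<sigma> (Box a \<phi>) = Box a (inst \<sigma> \<phi>)"
| "inst \<sigma> (Var X) = \<sigma> X"
| "inst \<sigma> (Fix \<eta> X \<phi>) = Fix \<eta> X (inst (\<sigma>(X := Var X)) \<phi>)"

definition unfold_fp :: "fp \<Rightarrow> 'v \<Rightarrow> ('p, 'a, 'v) fm \<Rightarrow> ('p, 'a, 'v) fm" where
  "unfold_fp \<eta> X \<phi> = inst (Var(X := Fix \<eta> X \<phi>)) \<phi>"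


section \<open>Neighbourhood semantics\<close>

record ('w, 'p, 'a) nbhd_model =
  worlds :: "'w set"
  nbhd :: "'a \<Rightarrow> 'w \<Rightarrow> 'w set set"
  interp :: "'p atom \<Rightarrow> 'w set"

definition is_model :: "('w, 'p, 'a) nbhd_model \<Rightarrow> bool" where
  "is_model M \<longleftrightarrow>
     (\<forall>a. \<forall>w \<in> worlds M. nbhd M a w \<subseteq> Pow (worlds M)) \<and>
     (\<forall>p. interp M p \<subseteq> worlds M \<and> interp M (dual p) = worlds M - interp M p)"

(* Intersecting with the worlds in the variable clause makes every extension a set of worlds,
   so that the fixpoints in the powerset of the type are those in the powerset of the worlds. *)
primrec sem :: "('w, 'p, 'a) nbhd_model \<Rightarrow> ('v \<Rightarrow> 'w set) \<Rightarrow> ('p, 'a, 'v) fm \<Rightarrow> 'w set" where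
  "sem M V Bot = {}"
| "sem M V Top = worlds M"
| "sem M V (Atom p) = interp M p"
| "sem M V (And \<phi> \<psi>) = sem M V \<phi> \<inter> sem M V \<psi>"
| "sem M V (Or \<phi> \<psi>) = sem M V \<phi> \<union> sem M V \<psi>"
| "sem M V (Dia a \<phi>) = {w \<in> worlds M. \<exists>S \<in> nbhd M a w. S \<subseteq> sem M V \<phi>}"
| "sem M V (Box a \<phi>) = {w \<in> worlds M. \<forall>S \<in> nbhd M a w. S \<inter> sem M V \<phi> \<noteq> {}}"
| "sem M V (Var X) = V X \<inter> worlds M"
| "sem M V (Fix \<eta> X \<phi>) =
     (case \<eta> of Mu \<Rightarrow> lfp (\<lambda>S. sem M (V(X := S)) \<phi>)
              | Nu \<Rightarrow> gfp (\<lambda>S. sem M (V(X := S)) \<phi>))"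

(* Meant for closed formulae, where the valuation is irrelevant. *)
definition holds :: "('w, 'p, 'a) nbhd_model \<Rightarrow> 'w \<Rightarrow> ('p, 'a, 'v) fm \<Rightarrow> bool" where
  "holds M w \<phi> \<longleftrightarrow> w \<in> sem M (\<lambda>_. {}) \<phi>"

definition satisfiable_under ::
    "'w itself \<Rightarrow> ('p, 'a, 'v) fm \<Rightarrow> ('p, 'a, 'v) fm \<Rightarrow> bool" where
  "satisfiable_under _ \<rho>0 \<rho>1 \<longleftrightarrow>
     (\<exists>M :: ('w, 'p, 'a) nbhd_model. is_model M \<and>
        (\<forall>w \<in> worlds M. holds M w \<rho>0) \<and> (\<exists>w \<in> worlds M. holds M w \<rho>1))"


section \<open>Closure and deferrals\<close>

inductive_set fl :: "('p, 'a, 'v) fm \<Rightarrow> ('p, 'a, 'v) fm set" for \<rho> where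
  fl_root: "\<rho> \<in> fl \<rho>"
| fl_And1: "And \<phi> \<psi> \<in> fl \<rho> \<Longrightarrow> \<phi> \<in> fl \<rho>"
| fl_And2: "And \<phi> \<psi> \<in> fl \<rho> \<Longrightarrow> \<psi> \<in> fl \<rho>"
| fl_Or1: "Or \<phi> \<psi> \<in> fl \<rho> \<Longrightarrow> \<phi> \<in> fl \<rho>"
| fl_Or2: "Or \<phi> \<psi> \<in> fl \<rho> \<Longrightarrow> \<psi> \<in> fl \<rho>"
| fl_Dia: "Dia a \<phi> \<in> fl \<rho> \<Longrightarrow> \<phi> \<in> fl \<rho>"
| fl_Box: "Box a \<phi> \<in> fl \<rho> \<Longrightarrow> \<phi> \<in> fl \<rho>"
| fl_Fix: "Fix \<eta> X \<phi> \<in> fl \<rho> \<Longrightarrow> unfold_fp \<eta> X \<phi> \<in> fl \<rho>"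

definition cl :: "('p, 'a, 'v) fm \<Rightarrow> ('p, 'a, 'v) fm \<Rightarrow> ('p, 'a, 'v) fm set" where
  "cl \<rho>0 \<rho>1 = fl \<rho>1 \<union> fl \<rho>0"

(* Subformula occurrences \<chi> of \<rho>, paired with the substitution that sends each variable whose
   binder has been passed to its binding formula, itself closed off by the outer binders.
   Hence inst \<sigma> \<chi> is the closure of \<chi>. *)
inductive_set occs ::
    "('p, 'a, 'v) fm \<Rightarrow> (('p, 'a, 'v) fm \<times> ('v \<Rightarrow> ('p, 'a, 'v) fm)) set" for \<rho> where
  occs_root: "(\<rho>, Var) \<in> occs \<rho>"
| occs_And1: "(And \<phi> \<psi>, \<sigma>) \<in> occs \<rho> \<Longrightarrow> (\<phi>, \<sigma>) \<in> occs \<rho>"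
| occs_And2: "(And \<phi> \<psi>, \<sigma>) \<in> occs \<rho> \<Longrightarrow> (\<psi>, \<sigma>) \<in> occs \<rho>"
| occs_Or1: "(Or \<phi> \<psi>, \<sigma>) \<in> occs \<rho> \<Longrightarrow> (\<phi>, \<sigma>) \<in> occs \<rho>"
| occs_Or2: "(Or \<phi> \<psi>, \<sigma>) \<in> occs \<rho> \<Longrightarrow> (\<psi>, \<sigma>) \<in> occs \<rho>"
| occs_Dia: "(Dia a \<phi>, \<sigma>) \<in> occs \<rho> \<Longrightarrow> (\<phi>, \<sigma>) \<in> occs \<rho>"
| occs_Box: "(Box a \<phi>, \<sigma>) \<in> occs \<rho> \<Longrightarrow> (\<phi>, \<sigma>) \<in> occs \<rho>"
| occs_Fix: "(Fix \<eta> X \<phi>, \<sigma>) \<in> occs \<rho> \<Longrightarrow> (\<phi>, \<sigma>(X := inst \<sigma> (Fix \<eta> X \<phi>))) \<in> occs \<rho>"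

definition deferrals :: "('p, 'a, 'v) fm \<Rightarrow> ('p, 'a, 'v) fm set" where
  "deferrals \<rho> =
     {inst \<sigma> \<chi> | \<chi> \<sigma>. (\<chi>, \<sigma>) \<in> occs \<rho> \<and> (\<exists>X \<in> fv \<chi>. \<exists>\<psi>. \<sigma> X = Fix Mu X \<psi>)}"

definition dfr :: "('p, 'a, 'v) fm \<Rightarrow> ('p, 'a, 'v) fm \<Rightarrow> ('p, 'a, 'v) fm set" where
  "dfr \<rho>0 \<rho>1 = deferrals \<rho>1 \<union> deferrals \<rho>0"


section \<open>Tableaux\<close>

datatype ('p, 'a, 'v) rule =
    RBot
  | RClash "'p atom"
  | RAnd "('p, 'a, 'v) fm" "('p, 'a, 'v) fm"
  | ROr "('p, 'a, 'v) fm" "('p, 'a, 'v) fm"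
  | RDia 'a "('p, 'a, 'v) fm" "('p, 'a, 'v) fm"
  | RFix fp 'v "('p, 'a, 'v) fm"

primrec principal_fms :: "('p, 'a, 'v) rule \<Rightarrow> ('p, 'a, 'v) fm set" where
  "principal_fms RBot = {Bot}"
| "principal_fms (RClash p) = {Atom p, Atom (dual p)}"
| "principal_fms (RAnd \<phi> \<psi>) = {And \<phi> \<psi>}"
| "principal_fms (ROr \<phi> \<psi>) = {Or \<phi> \<psi>}"
| "principal_fms (RDia a \<phi> \<psi>) = {Dia a \<phi>, Box a \<psi>}"
| "principal_fms (RFix \<eta> X \<phi>) = {Fix \<eta> X \<phi>}"

definition applicable :: "('p, 'a, 'v) rule \<Rightarrow> ('p, 'a, 'v) fm set \<Rightarrow> bool" where
  "applicable r \<Delta> \<longleftrightarrow> principal_fms r \<subseteq> \<Delta>"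

definition modal :: "('p, 'a, 'v) rule \<Rightarrow> bool" where
  "modal r \<longleftrightarrow> (\<exists>a \<phi> \<psi>. r = RDia a \<phi> \<psi>)"

(* \<Delta> is the whole premise. Its context, the \<Gamma> of a premise "\<Gamma>, \<phi>", is \<Delta> without the principal
   formulae: if a principal formula could survive in the context, then {Bot, And Top Top}
   could be expanded forever. *)
primrec conclusions ::
    "('p, 'a, 'v) fm \<Rightarrow> ('p, 'a, 'v) fm set \<Rightarrow> ('p, 'a, 'v) rule \<Rightarrow> ('p, 'a, 'v) fm set list" where
  "conclusions \<rho>0 \<Delta> RBot = []"
| "conclusions \<rho>0 \<Delta> (RClash p) = []"
| "conclusions \<rho>0 \<Delta> (RAnd \<phi> \<psi>) = [(\<Delta> - {And \<phi> \<psi>}) \<union> {\<phi>, \<psi>}]"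
| "conclusions \<rho>0 \<Delta> (ROr \<phi> \<psi>) = [(\<Delta> - {Or \<phi> \<psi>}) \<union> {\<phi>}, (\<Delta> - {Or \<phi> \<psi>}) \<union> {\<psi>}]"
| "conclusions \<rho>0 \<Delta> (RDia a \<phi> \<psi>) = [{\<phi>, \<psi>, \<rho>0}]"
| "conclusions \<rho>0 \<Delta> (RFix \<eta> X \<phi>) = [(\<Delta> - {Fix \<eta> X \<phi>}) \<union> {unfold_fp \<eta> X \<phi>}]"

definition formal_state ::
    "('p, 'a, 'v) fm \<Rightarrow> ('p, 'a, 'v) fm \<Rightarrow> ('p, 'a, 'v) fm set \<Rightarrow> bool" where
  "formal_state \<rho>0 \<rho>1 \<Gamma> \<longleftrightarrow>
     \<Gamma> \<subseteq> cl \<rho>0 \<rho>1 \<and> Bot \<notin> \<Gamma> \<and>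
     (\<forall>p. \<not> {Atom p, Atom (dual p)} \<subseteq> \<Gamma>) \<and>
     (\<forall>\<phi> \<psi>. And \<phi> \<psi> \<notin> \<Gamma>) \<and> (\<forall>\<phi> \<psi>. Or \<phi> \<psi> \<notin> \<Gamma>) \<and> (\<forall>\<eta> X \<phi>. Fix \<eta> X \<phi> \<notin> \<Gamma>)"

(* A rule together with the index of the selected conclusion. *)
type_synonym ('p, 'a, 'v) step = "('p, 'a, 'v) rule \<times> nat"

(* An edge records the step it stands for, since the two labels alone need not determine the
   rule application or the chosen disjunct. As the graphs are finite, nat is a sufficient supply
   of nodes. *)
record ('p, 'a, 'v) graph =
  nodes :: "nat set"
  edges :: "(nat \<times> ('p, 'a, 'v) step \<times> nat) set"
  label :: "nat \<Rightarrow> ('p, 'a, 'v) fm set"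

definition pre_tableau ::
    "('p, 'a, 'v) fm \<Rightarrow> ('p, 'a, 'v) fm \<Rightarrow> ('p, 'a, 'v) graph \<Rightarrow> bool" where
  "pre_tableau \<rho>0 \<rho>1 T \<longleftrightarrow>
     finite (nodes T) \<and>
     (\<forall>v \<in> nodes T. label T v \<subseteq> cl \<rho>0 \<rho>1) \<and>
     (\<forall>v r i u. (v, (r, i), u) \<in> edges T \<longrightarrow>
        v \<in> nodes T \<and> u \<in> nodes T \<and> applicable r (label T v) \<and>
        i < length (conclusions \<rho>0 (label T v) r) \<and>
        label T u = conclusions \<rho>0 (label T v) r ! i) \<and>
     (\<forall>v \<in> nodes T. formal_state \<rho>0 \<rho>1 (label T v) \<longrightarrow>
        (\<forall>r. applicable r (label T v) \<longrightarrow> (\<exists>i u. (v, (r, i), u) \<in> edges T))) \<and>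
     (\<forall>v \<in> nodes T. \<not> formal_state \<rho>0 \<rho>1 (label T v) \<longrightarrow>
        (\<exists>r i u. \<not> modal r \<and> {e \<in> edges T. fst e = v} = {(v, (r, i), u)}))"

(* The tracking function; D is the set of deferrals. *)
fun track ::
    "('p, 'a, 'v) fm set \<Rightarrow> ('p, 'a, 'v) fm \<Rightarrow> ('p, 'a, 'v) step \<Rightarrow> ('p, 'a, 'v) fm set" where
  "track D \<chi> (RBot, i) = {}"
| "track D \<chi> (RClash p, i) = {}"
| "track D \<chi> (RAnd \<phi> \<psi>, i) = (if \<chi> = And \<phi> \<psi> then {\<phi>, \<psi>} \<inter> D else {\<chi>})"
| "track D \<chi> (ROr \<phi> \<psi>, i) =
     (if \<chi> = Or \<phi> \<psi> then {if i = 0 then \<phi> else \<psi>} \<inter> D else {\<chi>})"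
| "track D \<chi> (RDia a \<phi> \<psi>, i) =
     ((if \<chi> = Dia a \<phi> then {\<phi>} else {}) \<union> (if \<chi> = Box a \<psi> then {\<psi>} else {})) \<inter> D"
| "track D \<chi> (RFix \<eta> X \<phi>, i) = (if \<chi> = Fix \<eta> X \<phi> then {unfold_fp \<eta> X \<phi>} \<inter> D else {\<chi>})"

definition infinite_trace ::
    "('p, 'a, 'v) fm set \<Rightarrow> ('p, 'a, 'v) graph \<Rightarrow> (nat \<Rightarrow> ('p, 'a, 'v) fm) \<Rightarrow> bool" where
  "infinite_trace D T \<phi> \<longleftrightarrow>
     (\<exists>(v :: nat \<Rightarrow> nat) s.
        (\<forall>i. (v i, s i, v (Suc i)) \<in> edges T) \<and>
        \<phi> 0 \<in> label T (v 0) \<inter> D \<and>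
        (\<forall>i. \<phi> (Suc i) \<in> track D (\<phi> i) (s i)))"

definition tableau ::
    "('p, 'a, 'v) fm \<Rightarrow> ('p, 'a, 'v) fm \<Rightarrow> ('p, 'a, 'v) graph \<Rightarrow> bool" where
  "tableau \<rho>0 \<rho>1 T \<longleftrightarrow>
     pre_tableau \<rho>0 \<rho>1 T \<and> \<not> (\<exists>\<phi>. infinite_trace (dfr \<rho>0 \<rho>1) T \<phi>)"

(* The rules add \<rho>0 only in modal steps, so the initial label has to contain it as well:
   for \<rho>1 = Atom (Pos p) and \<rho>0 = Atom (Neg p) the single node labelled {\<rho>1} is a tableau. *)
definition tableau_for ::
    "('p, 'a, 'v) fm \<Rightarrow> ('p, 'a, 'v) fm \<Rightarrow> ('p, 'a, 'v) graph \<Rightarrow> bool" where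
  "tableau_for \<rho>0 \<rho>1 T \<longleftrightarrow>
     tableau \<rho>0 \<rho>1 T \<and> (\<exists>v \<in> nodes T. \<rho>1 \<in> label T v \<and> \<rho>0 \<in> label T v)"

end

(* From a model to a tableau: deferrals holding in the model are fulfilled after finitely many
   steps, so the set lfp just of grounded pairs of a world and a deferral contains all true ones.
   Nodes of the tableau are pairs (\<Gamma>, F) of a satisfied label and a focus F of deferrals being
   tracked; when the focus becomes empty it is reset to all deferrals of the label. An infinite
   trace would eventually stay in the focus forever, but a choice of rules that empties the
   focus in boundedly many steps exists:
   non-modal expansion terminates by guardedness, and a modal step moves every tracked deferral one
   stage down in the construction of the fixpoint.

   From a tableau to a model: the worlds are the state nodes reachable by non-modal edges from
   nodes whose label contains \<rho>0, and every Dia a \<phi> in the label of a state contributes one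
   neighbourhood, the states below the conclusions of the modal rules with principal formula Dia a \<phi>. Truth of
   the labels is shown by induction on the size of closed subformulae. In a fixpoint formula all
   open subformulae met before reaching a smaller closed one have the same kind of fixpoint
   variable, by alternation-freeness: for \<mu> the well-founded trace relation is used, for \<nu> the
   sets of labelled states are a post-fixpoint. *)

theory Submission
  imports Defs
begin

section \<open>Substitution\<close>

lemma inst_cong: "(\<And>X. X \<in> fv \<phi> \<Longrightarrow> \<sigma> X = \<tau> X) \<Longrightarrow> inst \<sigma> \<phi> = inst \<tau> \<phi>"
proof (induction \<phi> arbitrary: \<sigma> \<tau>)
  case (And \<phi> \<psi>)
  show ?case using And.IH(1)[of \<sigma> \<tau>] And.IH(2)[of \<sigma> \<tau>] And.prems by simp
next
  case (Or \<phi> \<psi>)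
  show ?case using Or.IH(1)[of \<sigma> \<tau>] Or.IH(2)[of \<sigma> \<tau>] Or.prems by simp
next
  case (Fix \<eta> X \<phi>)
  have "inst (\<sigma>(X := Var X)) \<phi> = inst (\<tau>(X := Var X)) \<phi>"
    by (rule Fix.IH) (use Fix.prems in auto)
  then show ?case by simp
next
  case (Dia a \<phi>)
  show ?case using Dia.IH[of \<sigma> \<tau>] Dia.prems by simp
next
  case (Box a \<phi>)
  show ?case using Box.IH[of \<sigma> \<tau>] Box.prems by simp
qed simp_all

lemma inst_Var: "inst Var \<phi> = \<phi>"
proof (induction \<phi>)
  case (Fix \<eta> X \<phi>)
  moreover have "Var(X := Var X) = Var"
    by auto
  ultimately show ?case
    by simp
qed auto

lemma inst_closed: "fv \<phi> = {} \<Longrightarrow> inst \<sigma> \<phi> = \<phi>"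
  using inst_cong[of \<phi> \<sigma> Var] by (simp add: inst_Var)

lemma fv_inst_subset: "fv (inst \<sigma> \<phi>) \<subseteq> (\<Union>X \<in> fv \<phi>. fv (\<sigma> X))"
proof (induction \<phi> arbitrary: \<sigma>)
  case (Fix \<eta> X \<phi>)
  have "fv (inst (\<sigma>(X := Var X)) \<phi>) \<subseteq> (\<Union>Y \<in> fv \<phi>. fv ((\<sigma>(X := Var X)) Y))"
    by (rule Fix.IH)
  also have "\<dots> \<subseteq> insert X (\<Union>Y \<in> fv \<phi> - {X}. fv (\<sigma> Y))"
    by (auto split: if_splits)
  finally show ?case
    by auto
qed (auto, blast+)

text \<open>As \<open>inst\<close> goes under binders without renaming, the first hypothesis
  excludes capture. Closed values are fixed by every substitution, so the second hypothesis survives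
  resetting a bound variable.\<close>

lemma inst_inst:
  assumes "\<And>X. X \<in> fv \<phi> \<Longrightarrow> fv (\<sigma> X) = {} \<or> \<sigma> X = Var X"
    and "\<And>X. X \<in> fv \<phi> \<Longrightarrow> inst \<tau> (\<sigma> X) = \<theta> X"
  shows "inst \<tau> (inst \<sigma> \<phi>) = inst \<theta> \<phi>"
  using assms
proof (induction \<phi> arbitrary: \<sigma> \<tau> \<theta>)
  case (Fix \<eta> Z \<phi>)
  have "inst (\<tau>(Z := Var Z)) ((\<sigma>(Z := Var Z)) X) = (\<theta>(Z := Var Z)) X" if "X \<in> fv \<phi>" for X
  proof (cases "X = Z")
    case False
    then have "X \<in> fv (Fix \<eta> Z \<phi>)"
      using that by simp
    then show ?thesis
      using False Fix.prems[of X] inst_closed[of "\<sigma> X"] by auto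
  qed simp
  moreover have "fv ((\<sigma>(Z := Var Z)) X) = {} \<or> (\<sigma>(Z := Var Z)) X = Var X" if "X \<in> fv \<phi>" for X
    using that Fix.prems(1)[of X] by auto
  ultimately have "inst (\<tau>(Z := Var Z)) (inst (\<sigma>(Z := Var Z)) \<phi>) = inst (\<theta>(Z := Var Z)) \<phi>"
    by (intro Fix.IH)
  then show ?case
    by simp
next
  case (And \<phi> \<psi>)
  show ?case using And.IH(1)[of \<sigma> \<tau> \<theta>] And.IH(2)[of \<sigma> \<tau> \<theta>] And.prems by simp
next
  case (Or \<phi> \<psi>)
  show ?case using Or.IH(1)[of \<sigma> \<tau> \<theta>] Or.IH(2)[of \<sigma> \<tau> \<theta>] Or.prems by simp
next
  case (Dia a \<phi>)
  show ?case using Dia.IH[of \<sigma> \<tau> \<theta>] Dia.prems by simp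
next
  case (Box a \<phi>)
  show ?case using Box.IH[of \<sigma> \<tau> \<theta>] Box.prems by simp
qed simp_all

text \<open>Links two views of a fixpoint formula: unfolding its closure is closing off its body
  with X sent to that closure, which is how \<open>occs\<close> extends the substitution at a
  binder.\<close>

lemma unfold_inst:
  assumes "\<And>Y. Y \<in> fv (Fix \<eta> X \<phi>) \<Longrightarrow> fv (\<sigma> Y) = {}"
  shows "unfold_fp \<eta> X (inst (\<sigma>(X := Var X)) \<phi>) = inst (\<sigma>(X := inst \<sigma> (Fix \<eta> X \<phi>))) \<phi>"
  unfolding unfold_fp_def
proof (rule inst_inst)
  fix Y assume "Y \<in> fv \<phi>"
  then show "fv ((\<sigma>(X := Var X)) Y) = {} \<or> (\<sigma>(X := Var X)) Y = Var Y"
    and "inst (Var(X := Fix \<eta> X (inst (\<sigma>(X := Var X)) \<phi>))) ((\<sigma>(X := Var X)) Y) =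
      (\<sigma>(X := inst \<sigma> (Fix \<eta> X \<phi>))) Y"
    using assms[of Y] inst_closed[of "\<sigma> Y"] by auto
qed

section \<open>Semantics\<close>

lemma sem_mono: "(\<And>X. V X \<subseteq> V' X) \<Longrightarrow> sem M V \<phi> \<subseteq> sem M V' \<phi>"
proof (induction \<phi> arbitrary: V V')
  case (Fix \<eta> X \<phi>)
  have "sem M (V(X := S)) \<phi> \<subseteq> sem M (V'(X := S)) \<phi>" for S
    by (rule Fix.IH) (simp add: Fix.prems)
  then show ?case
    by (cases \<eta>) (simp_all add: lfp_mono gfp_mono)
next
  case (And \<phi> \<psi>)
  have "sem M V \<phi> \<subseteq> sem M V' \<phi>" "sem M V \<psi> \<subseteq> sem M V' \<psi>"
    by (rule And.IH, rule And.prems)+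
  then show ?case by auto
next
  case (Or \<phi> \<psi>)
  have "sem M V \<phi> \<subseteq> sem M V' \<phi>" "sem M V \<psi> \<subseteq> sem M V' \<psi>"
    by (rule Or.IH, rule Or.prems)+
  then show ?case by auto
next
  case (Dia a \<phi>)
  have "sem M V \<phi> \<subseteq> sem M V' \<phi>"
    by (rule Dia.IH, rule Dia.prems)
  then show ?case by (simp, blast)
next
  case (Box a \<phi>)
  have "sem M V \<phi> \<subseteq> sem M V' \<phi>"
    by (rule Box.IH, rule Box.prems)
  then show ?case by (simp, blast)
qed auto

lemma sem_upd_mono: "mono (\<lambda>S. sem M (V(X := S)) \<phi>)"
  by (rule monoI, rule sem_mono) simp

lemma sem_Fix_unfold:
  "sem M V (Fix \<eta> X \<phi>) = sem M (V(X := sem M V (Fix \<eta> X \<phi>))) \<phi>"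
  using lfp_unfold[OF sem_upd_mono, of M V X \<phi>] gfp_unfold[OF sem_upd_mono, of M V X \<phi>]
  by (cases \<eta>) simp_all

lemma sem_subset_worlds: "is_model M \<Longrightarrow> sem M V \<phi> \<subseteq> worlds M"
proof (induction \<phi> arbitrary: V)
  case (Fix \<eta> X \<phi>)
  then show ?case
    by (subst sem_Fix_unfold) blast
qed (auto simp: is_model_def)

lemma sem_cong:
  "(\<And>X. X \<in> fv \<phi> \<Longrightarrow> V X \<inter> worlds M = V' X \<inter> worlds M) \<Longrightarrow> sem M V \<phi> = sem M V' \<phi>"
proof (induction \<phi> arbitrary: V V')
  case (Fix \<eta> X \<phi>)
  have "sem M (V(X := S)) \<phi> = sem M (V'(X := S)) \<phi>" for S
    by (rule Fix.IH) (use Fix.prems in auto)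
  then show ?case
    by (cases \<eta>) simp_all
next
  case (And \<phi> \<psi>)
  show ?case using And.IH(1)[of V V'] And.IH(2)[of V V'] And.prems by simp
next
  case (Or \<phi> \<psi>)
  show ?case using Or.IH(1)[of V V'] Or.IH(2)[of V V'] Or.prems by simp
next
  case (Dia a \<phi>)
  show ?case using Dia.IH[of V V'] Dia.prems by simp
next
  case (Box a \<phi>)
  show ?case using Box.IH[of V V'] Box.prems by simp
qed auto

lemma sem_closed: "fv \<phi> = {} \<Longrightarrow> sem M V \<phi> = {w. holds M w \<phi>}"
  unfolding holds_def using sem_cong[of \<phi> V M "\<lambda>_. {}"] by simp

text \<open>In a model the extension of \<open>\<sigma> X\<close> consists of worlds, which absorbs
  the intersection in the variable clause.\<close>

lemma sem_inst:
  assumes "\<And>X. X \<in> fv \<phi> \<Longrightarrow> fv (\<sigma> X) = {} \<or> \<sigma> X = Var X" and "is_model M"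
  shows "sem M V (inst \<sigma> \<phi>) = sem M (\<lambda>X. sem M V (\<sigma> X)) \<phi>"
  using assms(1)
proof (induction \<phi> arbitrary: \<sigma> V)
  case (Fix \<eta> Z \<phi>)
  have "sem M (V(Z := S)) (inst (\<sigma>(Z := Var Z)) \<phi>) = sem M ((\<lambda>X. sem M V (\<sigma> X))(Z := S)) \<phi>" for S
  proof -
    have "sem M (V(Z := S)) (inst (\<sigma>(Z := Var Z)) \<phi>) =
        sem M (\<lambda>X. sem M (V(Z := S)) ((\<sigma>(Z := Var Z)) X)) \<phi>"
      by (rule Fix.IH) (use Fix.prems in auto)
    also have "\<dots> = sem M ((\<lambda>X. sem M V (\<sigma> X))(Z := S)) \<phi>"
    proof (rule sem_cong)
      fix X assume "X \<in> fv \<phi>"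
      then show "sem M (V(Z := S)) ((\<sigma>(Z := Var Z)) X) \<inter> worlds M =
          ((\<lambda>X. sem M V (\<sigma> X))(Z := S)) X \<inter> worlds M"
        using Fix.prems[of X] sem_closed[of "\<sigma> X" M] by (cases "X = Z") auto
    qed
    finally show ?thesis .
  qed
  then show ?case
    by (cases \<eta>) simp_all
next
  case (Var X)
  then show ?case
    using sem_subset_worlds[OF assms(2)] by auto
next
  case (And \<phi> \<psi>)
  show ?case using And.IH(1)[of \<sigma> V] And.IH(2)[of \<sigma> V] And.prems by simp
next
  case (Or \<phi> \<psi>)
  show ?case using Or.IH(1)[of \<sigma> V] Or.IH(2)[of \<sigma> V] Or.prems by simp
next
  case (Dia a \<phi>)
  show ?case using Dia.IH[of \<sigma> V] Dia.prems by simp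
next
  case (Box a \<phi>)
  show ?case using Box.IH[of \<sigma> V] Box.prems by simp
qed auto

lemma holds_unfold:
  assumes "fv (Fix \<eta> X \<phi>) = {}" "is_model M"
  shows "holds M w (unfold_fp \<eta> X \<phi>) \<longleftrightarrow> holds M w (Fix \<eta> X \<phi>)"
proof -
  let ?V = "\<lambda>_. {}"
  have "sem M ?V (unfold_fp \<eta> X \<phi>) = sem M (\<lambda>Y. sem M ?V ((Var(X := Fix \<eta> X \<phi>)) Y)) \<phi>"
    unfolding unfold_fp_def by (rule sem_inst) (use assms in auto)
  also have "\<dots> = sem M (?V(X := sem M ?V (Fix \<eta> X \<phi>))) \<phi>"
    by (rule sem_cong) (use assms in auto)
  also have "\<dots> = sem M ?V (Fix \<eta> X \<phi>)"
    by (rule sem_Fix_unfold[symmetric])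
  finally show ?thesis
    by (simp add: holds_def)
qed

lemma holds_simps:
  "holds M w (And \<phi> \<psi>) \<longleftrightarrow> holds M w \<phi> \<and> holds M w \<psi>"
  "holds M w (Or \<phi> \<psi>) \<longleftrightarrow> holds M w \<phi> \<or> holds M w \<psi>"
  "holds M w (Dia a \<phi>) \<longleftrightarrow> w \<in> worlds M \<and> (\<exists>S \<in> nbhd M a w. \<forall>u \<in> S. holds M u \<phi>)"
  "holds M w (Box a \<phi>) \<longleftrightarrow> w \<in> worlds M \<and> (\<forall>S \<in> nbhd M a w. \<exists>u \<in> S. holds M u \<phi>)"
  unfolding holds_def by auto

section \<open>Subformula occurrences\<close>

lemma subfms_refl: "\<phi> \<in> subfms \<phi>"
  by (cases \<phi>) auto

lemma subfms_trans: "\<phi> \<in> subfms \<psi> \<Longrightarrow> \<psi> \<in> subfms \<chi> \<Longrightarrow> \<phi> \<in> subfms \<chi>"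
  by (induction \<chi>) auto

lemma subfms_immediate:
  "And \<phi> \<psi> \<in> subfms \<chi> \<Longrightarrow> \<phi> \<in> subfms \<chi>"
  "And \<phi> \<psi> \<in> subfms \<chi> \<Longrightarrow> \<psi> \<in> subfms \<chi>"
  "Or \<phi> \<psi> \<in> subfms \<chi> \<Longrightarrow> \<phi> \<in> subfms \<chi>"
  "Or \<phi> \<psi> \<in> subfms \<chi> \<Longrightarrow> \<psi> \<in> subfms \<chi>"
  "Dia a \<phi> \<in> subfms \<chi> \<Longrightarrow> \<phi> \<in> subfms \<chi>"
  "Box a \<phi> \<in> subfms \<chi> \<Longrightarrow> \<phi> \<in> subfms \<chi>"
  "Fix \<eta> X \<phi> \<in> subfms \<chi> \<Longrightarrow> \<phi> \<in> subfms \<chi>"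
  by (rule subfms_trans, simp_all add: subfms_refl; simp add: subfms_refl)+

lemmas occs_steps =
  occs_And1 occs_And2 occs_Or1 occs_Or2 occs_Dia occs_Box occs_Fix

lemma occs_subfms: "(\<chi>, \<sigma>) \<in> occs \<rho> \<Longrightarrow> \<chi> \<in> subfms \<rho>"
  by (induction \<chi> \<sigma> rule: occs.induct) (blast intro: subfms_refl subfms_immediate)+

text \<open>As \<rho> is closed, a variable free in an occurrence has been passed at a binder, and
  the substitution stores the closure of the innermost one. The nesting
  \<open>\<chi> \<in> subfms \<phi>\<close> is what alternation-freeness is applied to.\<close>

lemma occs_binder:
  assumes "(\<chi>, \<sigma>) \<in> occs \<rho>" "fv \<rho> = {}" "X \<in> fv \<chi>"
  shows "\<exists>\<eta> \<phi> \<tau>. \<sigma> X = inst \<tau> (Fix \<eta> X \<phi>) \<and> (Fix \<eta> X \<phi>, \<tau>) \<in> occs \<rho> \<and> \<chi> \<in> subfms \<phi>"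
  using assms
proof (induction \<chi> \<sigma> rule: occs.induct)
  case (occs_Fix \<eta> Y \<phi> \<sigma>)
  show ?case
  proof (cases "X = Y")
    case True
    then show ?thesis
      using occs_Fix.hyps subfms_refl by (metis fun_upd_same)
  next
    case False
    then have "X \<in> fv (Fix \<eta> Y \<phi>)"
      using occs_Fix.prems by simp
    then show ?thesis
      using occs_Fix.IH occs_Fix.prems False subfms_immediate(7) by (metis fun_upd_other)
  qed
qed (simp; metis subfms_immediate)+

lemma occs_closed:
  assumes "(\<chi>, \<sigma>) \<in> occs \<rho>" "fv \<rho> = {}" "X \<in> fv \<chi>"
  shows "fv (\<sigma> X) = {}"
  using assms
proof (induction \<chi> \<sigma> arbitrary: X rule: occs.induct)
  case (occs_Fix \<eta> Y \<phi> \<sigma>)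
  have "fv (inst \<sigma> (Fix \<eta> Y \<phi>)) = {}"
    using fv_inst_subset[of \<sigma> "Fix \<eta> Y \<phi>"] occs_Fix.IH occs_Fix.prems(1) by blast
  then show ?case
    using occs_Fix.IH[of X] occs_Fix.prems by (cases "X = Y") auto
qed auto

lemma occs_inst_closed:
  assumes "(\<chi>, \<sigma>) \<in> occs \<rho>" "fv \<rho> = {}"
  shows "fv (inst \<sigma> \<chi>) = {}"
  using occs_closed[OF assms] fv_inst_subset[of \<sigma> \<chi>] by blast

lemma occs_unfold:
  assumes "(Fix \<eta> X \<phi>, \<sigma>) \<in> occs \<rho>" "fv \<rho> = {}"
  shows "unfold_fp \<eta> X (inst (\<sigma>(X := Var X)) \<phi>) = inst (\<sigma>(X := inst \<sigma> (Fix \<eta> X \<phi>))) \<phi>"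
  by (rule unfold_inst) (rule occs_closed[OF assms])

lemma subfms_occs: "\<beta> \<in> subfms \<phi> \<Longrightarrow> (\<phi>, \<sigma>) \<in> occs \<rho> \<Longrightarrow> \<exists>\<tau>. (\<beta>, \<tau>) \<in> occs \<rho>"
  by (induction \<phi> arbitrary: \<sigma>) (auto dest: occs_steps)

text \<open>The two substitutions may differ outside the free variables of \<open>\<chi>\<close>, on variables bound
  outside \<open>\<beta>\<close>.\<close>

lemma occs_embed:
  assumes "(\<chi>, \<sigma>) \<in> occs \<beta>" "(\<beta>, \<tau>) \<in> occs \<rho>" "fv \<beta> = {}"
  shows "\<exists>\<theta>. (\<chi>, \<theta>) \<in> occs \<rho> \<and> (\<forall>X \<in> fv \<chi>. \<theta> X = \<sigma> X)"
  using assms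
proof (induction \<chi> \<sigma> rule: occs.induct)
  case occs_root
  then show ?case by blast
next
  case (occs_Fix \<eta> X \<phi> \<sigma>)
  then obtain \<theta> where \<theta>: "(Fix \<eta> X \<phi>, \<theta>) \<in> occs \<rho>" "\<forall>Y \<in> fv (Fix \<eta> X \<phi>). \<theta> Y = \<sigma> Y"
    by blast
  have "inst \<theta> (Fix \<eta> X \<phi>) = inst \<sigma> (Fix \<eta> X \<phi>)"
    by (rule inst_cong) (use \<theta>(2) in blast)
  then have "\<forall>Y \<in> fv \<phi>. (\<theta>(X := inst \<theta> (Fix \<eta> X \<phi>))) Y = (\<sigma>(X := inst \<sigma> (Fix \<eta> X \<phi>))) Y"
    using \<theta>(2) by (metis DiffI empty_iff fun_upd_apply fv.simps(9) insert_iff)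
  then show ?case
    using occs.occs_Fix[OF \<theta>(1)] by blast
qed (fastforce dest: occs_steps)+

text \<open>Induction along the path from the root. A variable free in a fixpoint formula is bound
  by an outer formula in whose body it lies, so \<open>alternation_free\<close> forces equal kinds
  at each new binder.\<close>

lemma occs_same_kind:
  assumes "(\<chi>, \<sigma>) \<in> occs \<rho>" "fv \<rho> = {}" "alternation_free \<rho>"
    and "X \<in> fv \<chi>" "Y \<in> fv \<chi>" "\<sigma> X = Fix \<eta> X' \<phi>" "\<sigma> Y = Fix \<eta>' Y' \<psi>"
  shows "\<eta> = \<eta>'"
proof -
  have *: "\<eta> = \<eta>'" if fx: "(Fix \<eta> Z \<xi>, \<tau>) \<in> occs \<rho>" and W: "W \<in> fv (Fix \<eta> Z \<xi>)" "\<tau> W = Fix \<eta>' W' \<zeta>"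
    for \<eta> Z \<xi> \<tau> W \<eta>' W' \<zeta>
  proof -
    obtain \<eta>'' \<phi>' \<tau>' where "\<tau> W = inst \<tau>' (Fix \<eta>'' W \<phi>')" "(Fix \<eta>'' W \<phi>', \<tau>') \<in> occs \<rho>"
      "Fix \<eta> Z \<xi> \<in> subfms \<phi>'"
      using occs_binder[OF fx assms(2) W(1)] by blast
    moreover from this have "\<eta>'' = \<eta>'"
      using W(2) by simp
    ultimately show ?thesis
      using assms(3) W(1) occs_subfms unfolding alternation_free_def by metis
  qed
  show ?thesis
    using assms(1,4-)
  proof (induction \<chi> \<sigma> arbitrary: X Y X' Y' \<eta> \<eta>' \<phi> \<psi> rule: occs.induct)
    case occs_root
    then show ?case
      using assms(2) by simp
  next
    case (occs_Fix \<kappa> Z \<xi> \<sigma>)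
    then show ?case
      using *[OF occs_Fix.hyps] by (auto split: if_splits)
  qed (auto, blast+)
qed

section \<open>The closure is finite\<close>

text \<open>An explicit finite enumeration of the occurrences other than the root, to bound the
  inductively defined set \<open>occs\<close>.\<close>

primrec occ_list :: "('v \<Rightarrow> ('p, 'a, 'v) fm) \<Rightarrow> ('p, 'a, 'v) fm \<Rightarrow>
    (('p, 'a, 'v) fm \<times> ('v \<Rightarrow> ('p, 'a, 'v) fm)) list" where
  "occ_list \<sigma> Bot = []"
| "occ_list \<sigma> Top = []"
| "occ_list \<sigma> (Atom p) = []"
| "occ_list \<sigma> (And \<phi> \<psi>) = (\<phi>, \<sigma>) # (\<psi>, \<sigma>) # occ_list \<sigma> \<phi> @ occ_list \<sigma> \<psi>"
| "occ_list \<sigma> (Or \<phi> \<psi>) = (\<phi>, \<sigma>) # (\<psi>, \<sigma>) # occ_list \<sigma> \<phi> @ occ_list \<sigma> \<psi>"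
| "occ_list \<sigma> (Dia a \<phi>) = (\<phi>, \<sigma>) # occ_list \<sigma> \<phi>"
| "occ_list \<sigma> (Box a \<phi>) = (\<phi>, \<sigma>) # occ_list \<sigma> \<phi>"
| "occ_list \<sigma> (Var X) = []"
| "occ_list \<sigma> (Fix \<eta> X \<phi>) = (let \<tau> = \<sigma>(X := inst \<sigma> (Fix \<eta> X \<phi>)) in (\<phi>, \<tau>) # occ_list \<tau> \<phi>)"

lemma finite_occs: "finite (occs \<rho>)"
proof -
  have *: "set (occ_list \<tau> \<psi>) \<subseteq> set (occ_list \<sigma> \<phi>)" if "(\<psi>, \<tau>) \<in> set (occ_list \<sigma> \<phi>)"
    for \<phi> \<psi> :: "('a, 'b, 'c) fm" and \<sigma> \<tau>
    using that by (induction \<phi> arbitrary: \<sigma>) (auto simp: Let_def)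
  have **: "set (occ_list \<tau> \<psi>) \<subseteq> insert (\<rho>, Var) (set (occ_list Var \<rho>))"
    if "(\<psi>, \<tau>) \<in> insert (\<rho>, Var) (set (occ_list Var \<rho>))" for \<psi> \<tau>
    using that *[of \<psi> \<tau>] by blast
  have "(\<chi>, \<sigma>) \<in> insert (\<rho>, Var) (set (occ_list Var \<rho>))" if "(\<chi>, \<sigma>) \<in> occs \<rho>" for \<chi> \<sigma>
    using that
    by (induction \<chi> \<sigma> rule: occs.induct) (rule insertI1 | drule **, unfold occ_list.simps Let_def list.set set_append, blast)+
  then show ?thesis
    by (meson finite.insertI finite_set finite_subset subrelI)
qed

text \<open>With \<chi> not a variable, the main connective of the instance is that of \<chi>, so
  every step of the closure is matched by a step of \<open>occs\<close>.\<close>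

lemma fl_occs:
  assumes "\<phi> \<in> fl \<rho>" "fv \<rho> = {}"
  shows "\<exists>\<chi> \<sigma>. (\<chi>, \<sigma>) \<in> occs \<rho> \<and> \<phi> = inst \<sigma> \<chi> \<and> (\<forall>X. \<chi> \<noteq> Var X)"
proof -
  \<comment> \<open>A variable occurrence is exchanged for the occurrence of its binder, which has
    the same instance.\<close>
  have *: "\<exists>\<chi> \<sigma>. (\<chi>, \<sigma>) \<in> occs \<rho> \<and> inst \<tau> \<xi> = inst \<sigma> \<chi> \<and> (\<forall>X. \<chi> \<noteq> Var X)"
    if "(\<xi>, \<tau>) \<in> occs \<rho>" for \<xi> \<tau>
  proof (cases "\<exists>X. \<xi> = Var X")
    case True
    then obtain X where "\<xi> = Var X" by blast
    then show ?thesis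
      using occs_binder[OF that assms(2), of X] by fastforce
  qed (use that in blast)
  show ?thesis
    using assms(1)
  proof (induction rule: fl.induct)
    case fl_root
    show ?case
      using *[OF occs_root] by (simp add: inst_Var)
  next
    case (fl_And1 \<phi> \<psi>)
    then obtain \<chi> \<sigma> where "(\<chi>, \<sigma>) \<in> occs \<rho>" "And \<phi> \<psi> = inst \<sigma> \<chi>" "\<forall>X. \<chi> \<noteq> Var X" by blast
    then show ?case by (cases \<chi> rule: fm.exhaust) (auto dest: occs_And1[THEN *])
  next
    case (fl_And2 \<phi> \<psi>)
    then obtain \<chi> \<sigma> where "(\<chi>, \<sigma>) \<in> occs \<rho>" "And \<phi> \<psi> = inst \<sigma> \<chi>" "\<forall>X. \<chi> \<noteq> Var X" by blast
    then show ?case by (cases \<chi> rule: fm.exhaust) (auto dest: occs_And2[THEN *])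
  next
    case (fl_Or1 \<phi> \<psi>)
    then obtain \<chi> \<sigma> where "(\<chi>, \<sigma>) \<in> occs \<rho>" "Or \<phi> \<psi> = inst \<sigma> \<chi>" "\<forall>X. \<chi> \<noteq> Var X" by blast
    then show ?case by (cases \<chi> rule: fm.exhaust) (auto dest: occs_Or1[THEN *])
  next
    case (fl_Or2 \<phi> \<psi>)
    then obtain \<chi> \<sigma> where "(\<chi>, \<sigma>) \<in> occs \<rho>" "Or \<phi> \<psi> = inst \<sigma> \<chi>" "\<forall>X. \<chi> \<noteq> Var X" by blast
    then show ?case by (cases \<chi> rule: fm.exhaust) (auto dest: occs_Or2[THEN *])
  next
    case (fl_Dia a \<phi>)
    then obtain \<chi> \<sigma> where "(\<chi>, \<sigma>) \<in> occs \<rho>" "Dia a \<phi> = inst \<sigma> \<chi>" "\<forall>X. \<chi> \<noteq> Var X" by blast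
    then show ?case by (cases \<chi> rule: fm.exhaust) (auto dest: occs_Dia[THEN *])
  next
    case (fl_Box a \<phi>)
    then obtain \<chi> \<sigma> where "(\<chi>, \<sigma>) \<in> occs \<rho>" "Box a \<phi> = inst \<sigma> \<chi>" "\<forall>X. \<chi> \<noteq> Var X" by blast
    then show ?case by (cases \<chi> rule: fm.exhaust) (auto dest: occs_Box[THEN *])
  next
    case (fl_Fix \<eta> X \<phi>)
    then obtain \<chi> \<sigma> where \<chi>: "(\<chi>, \<sigma>) \<in> occs \<rho>" "Fix \<eta> X \<phi> = inst \<sigma> \<chi>" "\<forall>X. \<chi> \<noteq> Var X" by blast
    then obtain \<psi> where \<psi>: "\<chi> = Fix \<eta> X \<psi>" "\<phi> = inst (\<sigma>(X := Var X)) \<psi>"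
      by (cases \<chi> rule: fm.exhaust) auto
    then show ?case
      using occs_unfold[of \<eta> X \<psi> \<sigma> \<rho>] \<chi>(1) assms(2) *[OF occs_Fix, of \<eta> X \<psi> \<sigma>] by simp
  qed
qed

lemma fl_closed: "\<phi> \<in> fl \<rho> \<Longrightarrow> fv \<rho> = {} \<Longrightarrow> fv \<phi> = {}"
  using fl_occs occs_inst_closed by metis

lemma finite_fl:
  assumes "fv \<rho> = {}"
  shows "finite (fl \<rho>)"
proof (rule finite_subset)
  show "fl \<rho> \<subseteq> (\<lambda>(\<chi>, \<sigma>). inst \<sigma> \<chi>) ` occs \<rho>"
    using fl_occs[OF _ assms] by force
  show "finite ((\<lambda>(\<chi>, \<sigma>). inst \<sigma> \<chi>) ` occs \<rho>)"
    using finite_occs by blast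
qed

section \<open>Termination of local expansion\<close>

text \<open>Modal formulae have rank 0, so that by guardedness an unfolding does not increase the rank
  of the body.\<close>

primrec rank :: "('p, 'a, 'v) fm \<Rightarrow> nat" where
  "rank Bot = 0"
| "rank Top = 0"
| "rank (Atom p) = 0"
| "rank (And \<phi> \<psi>) = Suc (rank \<phi> + rank \<psi>)"
| "rank (Or \<phi> \<psi>) = Suc (rank \<phi> + rank \<psi>)"
| "rank (Dia a \<phi>) = 0"
| "rank (Box a \<phi>) = 0"
| "rank (Var X) = 0"
| "rank (Fix \<eta> X \<phi>) = Suc (rank \<phi>)"

lemma rank_inst: "(\<And>X. X \<in> unguarded_fv \<phi> \<Longrightarrow> \<sigma> X = Var X) \<Longrightarrow> rank (inst \<sigma> \<phi>) = rank \<phi>"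
  by (induction \<phi> arbitrary: \<sigma>) auto

lemma unguarded_fv_subset: "unguarded_fv \<phi> \<subseteq> fv \<phi>"
  by (induction \<phi>) auto

lemma unguarded_fv_inst_subset: "unguarded_fv (inst \<sigma> \<phi>) \<subseteq> (\<Union>X \<in> unguarded_fv \<phi>. fv (\<sigma> X))"
proof (induction \<phi> arbitrary: \<sigma>)
  case (Var X)
  show ?case by (simp add: unguarded_fv_subset)
next
  case (Fix \<eta> X \<phi>)
  have "unguarded_fv (inst (\<sigma>(X := Var X)) \<phi>) \<subseteq> (\<Union>Y \<in> unguarded_fv \<phi>. fv ((\<sigma>(X := Var X)) Y))"
    by (rule Fix.IH)
  also have "\<dots> \<subseteq> insert X (\<Union>Y \<in> unguarded_fv \<phi> - {X}. fv (\<sigma> Y))"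
    by (auto split: if_splits)
  finally show ?case
    by auto
qed (auto, blast+)

text \<open>Guardedness is given for \<rho>, so it is first carried over to the instance in the
  closure. Unfolding then changes the body only below modal operators and keeps its rank, one less
  than that of the fixpoint formula.\<close>

lemma rank_unfold:
  assumes "Fix \<eta> X \<phi> \<in> fl \<rho>" "fv \<rho> = {}" "guarded \<rho>"
  shows "rank (unfold_fp \<eta> X \<phi>) < rank (Fix \<eta> X \<phi>)"
proof -
  obtain \<chi> \<sigma> where \<chi>: "(\<chi>, \<sigma>) \<in> occs \<rho>" "Fix \<eta> X \<phi> = inst \<sigma> \<chi>" "\<forall>X. \<chi> \<noteq> Var X"
    using fl_occs[OF assms(1,2)] by blast
  then obtain \<psi> where \<psi>: "\<chi> = Fix \<eta> X \<psi>" "\<phi> = inst (\<sigma>(X := Var X)) \<psi>"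
    by (cases \<chi> rule: fm.exhaust) auto
  have ung: "X \<notin> unguarded_fv \<psi>"
    using assms(3) occs_subfms[OF \<chi>(1)] \<psi>(1) unfolding guarded_def by blast
  have "fv (\<sigma> Y) = {}" if "Y \<in> unguarded_fv \<psi>" for Y
    using occs_closed[OF \<chi>(1) assms(2), of Y] that ung unguarded_fv_subset[of \<psi>] \<psi>(1) by auto
  then have "X \<notin> unguarded_fv \<phi>"
    using unguarded_fv_inst_subset[of "\<sigma>(X := Var X)" \<psi>] ung \<psi>(2) by (auto split: if_splits)
  then have "rank (unfold_fp \<eta> X \<phi>) = rank \<phi>"
    unfolding unfold_fp_def by (intro rank_inst) auto
  then show ?thesis by simp
qed

section \<open>Closure, deferrals and rule applications\<close>

locale formula_pair =
  fixes \<rho>0 \<rho>1 :: "('p, 'a, 'v) fm"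
  assumes closed: "\<rho> \<in> {\<rho>0, \<rho>1} \<Longrightarrow> fv \<rho> = {}"
    and irred: "\<rho> \<in> {\<rho>0, \<rho>1} \<Longrightarrow> irredundant \<rho>"
    and guarded: "\<rho> \<in> {\<rho>0, \<rho>1} \<Longrightarrow> guarded \<rho>"
    and alt_free: "\<rho> \<in> {\<rho>0, \<rho>1} \<Longrightarrow> alternation_free \<rho>"
begin

abbreviation C where "C \<equiv> cl \<rho>0 \<rho>1"
abbreviation D where "D \<equiv> dfr \<rho>0 \<rho>1"
abbreviation concl where "concl \<equiv> conclusions \<rho>0"
abbreviation state where "state \<equiv> formal_state \<rho>0 \<rho>1"

text \<open>Deferrals ask for one free variable bound by \<mu>. Asking it of all is equivalent for
  open occurrences by alternation-freeness, and is inherited by components; closed formulae satisfy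
  it vacuously.\<close>

definition mu_bound :: "('v \<Rightarrow> ('p, 'a, 'v) fm) \<Rightarrow> ('p, 'a, 'v) fm \<Rightarrow> bool" where
  "mu_bound \<sigma> \<chi> \<longleftrightarrow> (\<forall>X \<in> fv \<chi>. \<exists>\<psi>. \<sigma> X = Fix Mu X \<psi>)"

lemma mem_cl: "\<phi> \<in> C \<longleftrightarrow> (\<exists>\<rho> \<in> {\<rho>0, \<rho>1}. \<phi> \<in> fl \<rho>)"
  by (auto simp: cl_def)

lemma finite_cl: "finite C"
  by (simp add: cl_def finite_fl closed)

lemma cl_closed: "\<phi> \<in> C \<Longrightarrow> fv \<phi> = {}"
  unfolding mem_cl using fl_closed[OF _ closed] by auto

lemma cl_steps:
  "And \<phi> \<psi> \<in> C \<Longrightarrow> \<phi> \<in> C"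
  "And \<phi> \<psi> \<in> C \<Longrightarrow> \<psi> \<in> C"
  "Or \<phi> \<psi> \<in> C \<Longrightarrow> \<phi> \<in> C"
  "Or \<phi> \<psi> \<in> C \<Longrightarrow> \<psi> \<in> C"
  "Dia a \<phi> \<in> C \<Longrightarrow> \<phi> \<in> C"
  "Box a \<phi> \<in> C \<Longrightarrow> \<phi> \<in> C"
  "Fix \<eta> X \<phi> \<in> C \<Longrightarrow> unfold_fp \<eta> X \<phi> \<in> C"
  by (auto simp: cl_def dest: fl.intros(2-))

lemma rho_cl: "\<rho>0 \<in> C" "\<rho>1 \<in> C"
  by (auto simp: cl_def fl_root)

lemma binder_occurs:
  assumes "(Fix \<eta> X \<phi>, \<sigma>) \<in> occs \<rho>" "\<rho> \<in> {\<rho>0, \<rho>1}"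
  shows "X \<in> fv \<phi>"
  using irred[OF assms(2)] occs_subfms[OF assms(1)] unfolding irredundant_def by blast

lemma dfrI:
  assumes "(\<chi>, \<sigma>) \<in> occs \<rho>" "\<rho> \<in> {\<rho>0, \<rho>1}" "X \<in> fv \<chi>" "\<sigma> X = Fix Mu X \<psi>"
  shows "inst \<sigma> \<chi> \<in> D"
  using assms unfolding dfr_def deferrals_def by blast

lemma dfrE:
  assumes "\<delta> \<in> D"
  obtains \<rho> \<chi> \<sigma> where "\<rho> \<in> {\<rho>0, \<rho>1}" "(\<chi>, \<sigma>) \<in> occs \<rho>" "\<delta> = inst \<sigma> \<chi>"
    "fv \<chi> \<noteq> {}" "mu_bound \<sigma> \<chi>"
proof -
  obtain \<rho> \<chi> \<sigma> X \<psi> where *: "\<rho> \<in> {\<rho>0, \<rho>1}" "(\<chi>, \<sigma>) \<in> occs \<rho>" "\<delta> = inst \<sigma> \<chi>"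
    "X \<in> fv \<chi>" "\<sigma> X = Fix Mu X \<psi>"
    using assms unfolding dfr_def deferrals_def by blast
  have "\<exists>\<psi>. \<sigma> Y = Fix Mu Y \<psi>" if Y: "Y \<in> fv \<chi>" for Y
  proof -
    obtain \<eta> \<phi> \<tau> where "\<sigma> Y = inst \<tau> (Fix \<eta> Y \<phi>)"
      using occs_binder[OF *(2) closed[OF *(1)] Y] by blast
    then show ?thesis
      using occs_same_kind[OF *(2) closed[OF *(1)] alt_free[OF *(1)] *(4) Y *(5)] by simp
  qed
  then have "mu_bound \<sigma> \<chi>"
    by (simp add: mu_bound_def)
  with * that show thesis
    by blast
qed

text \<open>By irredundance X occurs in the body. A further free variable, sent to a \<mu>-formula,
  would put both kinds among the free variables of the body, against alternation-freeness.\<close>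

lemma mu_bound_Nu_closed:
  assumes "(Fix Nu X \<phi>, \<sigma>) \<in> occs \<rho>" "\<rho> \<in> {\<rho>0, \<rho>1}" "mu_bound \<sigma> (Fix Nu X \<phi>)"
  shows "fv (Fix Nu X \<phi>) = {}"
proof (rule ccontr)
  assume "fv (Fix Nu X \<phi>) \<noteq> {}"
  then obtain Y where Y: "Y \<in> fv \<phi>" "Y \<noteq> X" by auto
  then obtain \<psi> where "\<sigma> Y = Fix Mu Y \<psi>"
    using assms(3) unfolding mu_bound_def by auto
  then show False
    using occs_same_kind[OF occs_Fix[OF assms(1)] closed[OF assms(2)] alt_free[OF assms(2)]
        Y(1) binder_occurs[OF assms(1,2)], of Mu Y \<psi> Nu X] Y(2) by simp
qed

text \<open>Every occurrence that could have this instance is excluded: a variable is sent to a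
  \<mu>-formula, and a \<nu>-occurrence would be closed, whereas deferrals come from open
  occurrences.\<close>

lemma Nu_notin_dfr: "Fix Nu X \<phi> \<notin> D"
proof
  assume "Fix Nu X \<phi> \<in> D"
  then obtain \<rho> \<chi> \<sigma> where *: "\<rho> \<in> {\<rho>0, \<rho>1}" "(\<chi>, \<sigma>) \<in> occs \<rho>" "Fix Nu X \<phi> = inst \<sigma> \<chi>"
    "fv \<chi> \<noteq> {}" "mu_bound \<sigma> \<chi>"
    by (rule dfrE)
  show False
  proof (cases \<chi> rule: fm.exhaust)
    case (Var Y)
    then show ?thesis using * by (auto simp: mu_bound_def)
  next
    case (Fix \<eta> Y \<psi>)
    then show ?thesis using * mu_bound_Nu_closed[of Y \<psi> \<sigma> \<rho>] by auto
  qed (use *(3) in auto)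
qed

definition weight :: "('p, 'a, 'v) fm set \<Rightarrow> nat" where
  "weight \<Delta> = sum rank \<Delta>"

lemma weight_replace:
  assumes "finite \<Delta>" "\<phi> \<in> \<Delta>" "sum rank A < rank \<phi>" "finite A"
  shows "weight ((\<Delta> - {\<phi>}) \<union> A) < weight \<Delta>"
proof -
  have "weight ((\<Delta> - {\<phi>}) \<union> A) \<le> sum rank (\<Delta> - {\<phi>}) + sum rank A"
    unfolding weight_def using assms(1,4) sum.union_inter[of "\<Delta> - {\<phi>}" A rank] by simp
  also have "\<dots> < sum rank (\<Delta> - {\<phi>}) + rank \<phi>"
    using assms(3) by simp
  also have "\<dots> = weight \<Delta>"
    unfolding weight_def using assms(1,2) by (simp add: sum.remove add.commute)
  finally show ?thesis .
qed

text \<open>Termination of local expansion, used in both directions. The principal formula leaves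
  the label, and its replacements have smaller total rank, for fixpoints by guardedness.\<close>

lemma concl_weight:
  assumes "\<Delta> \<subseteq> C" "\<not> modal r" "applicable r \<Delta>" "i < length (concl \<Delta> r)"
  shows "weight (concl \<Delta> r ! i) < weight \<Delta>"
proof -
  have fin: "finite \<Delta>"
    using assms(1) finite_cl finite_subset by blast
  show ?thesis
  proof (cases r)
    case (RAnd \<phi> \<psi>)
    have "sum rank {\<phi>, \<psi>} < rank (And \<phi> \<psi>)"
      by (cases "\<phi> = \<psi>") auto
    then show ?thesis
      using weight_replace[OF fin, of "And \<phi> \<psi>" "{\<phi>, \<psi>}"] RAnd assms(3,4) by (simp add: applicable_def)
  next
    case (ROr \<phi> \<psi>)
    then have "Or \<phi> \<psi> \<in> \<Delta>"
      using assms(3) by (simp add: applicable_def)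
    then have "weight (\<Delta> - {Or \<phi> \<psi>} \<union> {\<phi>}) < weight \<Delta>" "weight (\<Delta> - {Or \<phi> \<psi>} \<union> {\<psi>}) < weight \<Delta>"
      by (intro weight_replace[OF fin]; simp)+
    then show ?thesis
      using ROr assms(4) by (auto simp: less_Suc_eq)
  next
    case (RFix \<eta> X \<phi>)
    then have "Fix \<eta> X \<phi> \<in> C"
      using assms(1,3) by (auto simp: applicable_def)
    then obtain \<rho> where "\<rho> \<in> {\<rho>0, \<rho>1}" "Fix \<eta> X \<phi> \<in> fl \<rho>"
      unfolding mem_cl by blast
    then have "rank (unfold_fp \<eta> X \<phi>) < rank (Fix \<eta> X \<phi>)"
      by (intro rank_unfold[OF _ closed guarded])
    then show ?thesis
      using weight_replace[OF fin, of "Fix \<eta> X \<phi>" "{unfold_fp \<eta> X \<phi>}"] RFix assms(3,4)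
      by (simp add: applicable_def)
  qed (use assms in \<open>auto simp: modal_def\<close>)
qed

lemma concl_cl:
  assumes "\<Delta> \<subseteq> C" "applicable r \<Delta>" "i < length (concl \<Delta> r)"
  shows "concl \<Delta> r ! i \<subseteq> C"
proof -
  have sub: "\<phi> \<in> C" if "\<phi> \<in> \<Delta>" for \<phi>
    using that assms(1) by blast
  show ?thesis
    by (cases r)
      (use assms(2,3) rho_cl in \<open>auto simp: applicable_def less_Suc_eq dest: cl_steps[OF sub] sub\<close>)
qed

lemma track_concl:
  assumes "\<chi> \<in> \<Delta>" "\<chi> \<in> D" "applicable r \<Delta>" "i < length (concl \<Delta> r)"
  shows "track D \<chi> (r, i) \<subseteq> concl \<Delta> r ! i \<inter> D"
proof (cases r)
  case (ROr \<phi> \<psi>)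
  then show ?thesis
    using assms by (auto simp: less_Suc_eq)
qed (use assms in auto)

lemma state_rule:
  assumes "state \<Gamma>" "applicable r \<Gamma>"
  obtains a \<phi> \<psi> where "r = RDia a \<phi> \<psi>" "Dia a \<phi> \<in> \<Gamma>" "Box a \<psi> \<in> \<Gamma>"
  using assms by (cases r) (auto simp: formal_state_def applicable_def)

end

section \<open>From models to tableaux\<close>

locale formula_pair_model = formula_pair \<rho>0 \<rho>1 for \<rho>0 \<rho>1 :: "('p, 'a, 'v) fm" +
  fixes M :: "('w, 'p, 'a) nbhd_model"
  assumes model: "is_model M"
    and global: "w \<in> worlds M \<Longrightarrow> holds M w \<rho>0"
begin

section \<open>Grounded pairs of worlds and formulae\<close>

definition grounded :: "('w \<times> ('p, 'a, 'v) fm) set \<Rightarrow> 'w \<Rightarrow> ('p, 'a, 'v) fm \<Rightarrow> bool" where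
  "grounded S w \<phi> \<longleftrightarrow> holds M w \<phi> \<and> (\<phi> \<in> D \<longrightarrow> (w, \<phi>) \<in> S)"

fun justified :: "('w \<times> ('p, 'a, 'v) fm) set \<Rightarrow> 'w \<Rightarrow> ('p, 'a, 'v) fm \<Rightarrow> bool" where
  "justified S w (And \<phi> \<psi>) \<longleftrightarrow> grounded S w \<phi> \<and> grounded S w \<psi>"
| "justified S w (Or \<phi> \<psi>) \<longleftrightarrow> grounded S w \<phi> \<or> grounded S w \<psi>"
| "justified S w (Dia a \<phi>) \<longleftrightarrow> (\<exists>U \<in> nbhd M a w. \<forall>u \<in> U. grounded S u \<phi>)"
| "justified S w (Box a \<phi>) \<longleftrightarrow> (\<forall>U \<in> nbhd M a w. \<exists>u \<in> U. grounded S u \<phi>)"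
| "justified S w (Fix \<eta> X \<phi>) \<longleftrightarrow> grounded S w (unfold_fp \<eta> X \<phi>)"
| "justified S w _ \<longleftrightarrow> True"

text \<open>One round of fulfilment. The stages of its least fixpoint replace the ordinal signatures
  by which least fixpoint formulae are usually measured.\<close>

definition just :: "('w \<times> ('p, 'a, 'v) fm) set \<Rightarrow> ('w \<times> ('p, 'a, 'v) fm) set" where
  "just S = {(w, \<phi>). holds M w \<phi> \<and> justified S w \<phi>}"

lemma mono_just: "mono just"
proof (rule monoI)
  fix S T :: "('w \<times> ('p, 'a, 'v) fm) set"
  assume "S \<subseteq> T"
  then have g: "grounded S w \<phi> \<Longrightarrow> grounded T w \<phi>" for w \<phi>
    by (auto simp: grounded_def)
  have "justified S w \<phi> \<Longrightarrow> justified T w \<phi>" for w \<phi>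
    by (cases \<phi>) (simp_all, (blast intro: g)+)
  then show "just S \<subseteq> just T"
    by (auto simp: just_def)
qed

definition E :: "('w \<times> ('p, 'a, 'v) fm) set" where
  "E = lfp just"

lemma grounded_holds: "grounded S w \<phi> \<Longrightarrow> holds M w \<phi>"
  by (simp add: grounded_def)

lemma grounded_intro: "holds M w \<phi> \<Longrightarrow> justified E w \<phi> \<Longrightarrow> grounded E w \<phi>"
  using lfp_unfold[OF mono_just] by (auto simp: grounded_def just_def E_def)

text \<open>For \<mu>, the worlds where the fixpoint formula is grounded form a pre-fixpoint, so
  they contain the least one; V is arbitrary so that this set can be assigned to X. A \<nu>-formula
  met here is closed and no deferral, so truth alone grounds it.\<close>

lemma sem_grounded:
  assumes "(\<chi>, \<sigma>) \<in> occs \<rho>" "\<rho> \<in> {\<rho>0, \<rho>1}" "mu_bound \<sigma> \<chi>"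
    and "\<And>X. X \<in> fv \<chi> \<Longrightarrow> V X \<inter> worlds M \<subseteq> {w. grounded E w (\<sigma> X)}"
  shows "sem M V \<chi> \<subseteq> {w. grounded E w (inst \<sigma> \<chi>)}"
  using assms(1,3,4)
proof (induction \<chi> arbitrary: \<sigma> V)
  case Top
  then show ?case by (auto intro!: grounded_intro simp: holds_def)
next
  case (Atom p)
  then show ?case by (auto intro!: grounded_intro simp: holds_def)
next
  case (And \<phi> \<psi>)
  have "sem M V \<phi> \<subseteq> {w. grounded E w (inst \<sigma> \<phi>)}" "sem M V \<psi> \<subseteq> {w. grounded E w (inst \<sigma> \<psi>)}"
    by (rule And.IH; use And.prems in \<open>auto dest: occs_steps simp: mu_bound_def\<close>)+
  then show ?case
    by (intro subsetI CollectI grounded_intro) (auto simp: holds_simps dest: grounded_holds)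
next
  case (Or \<phi> \<psi>)
  have "sem M V \<phi> \<subseteq> {w. grounded E w (inst \<sigma> \<phi>)}" "sem M V \<psi> \<subseteq> {w. grounded E w (inst \<sigma> \<psi>)}"
    by (rule Or.IH; use Or.prems in \<open>auto dest: occs_steps simp: mu_bound_def\<close>)+
  then show ?case
    by (intro subsetI CollectI grounded_intro) (auto simp: holds_simps dest: grounded_holds)
next
  case (Dia a \<phi>)
  have "sem M V \<phi> \<subseteq> {w. grounded E w (inst \<sigma> \<phi>)}"
    by (rule Dia.IH; use Dia.prems in \<open>auto dest: occs_steps simp: mu_bound_def\<close>)
  then show ?case
    by (intro subsetI CollectI grounded_intro) (auto simp: holds_simps dest: grounded_holds)
next
  case (Box a \<phi>)
  have "sem M V \<phi> \<subseteq> {w. grounded E w (inst \<sigma> \<phi>)}"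
    by (rule Box.IH; use Box.prems in \<open>auto dest: occs_steps simp: mu_bound_def\<close>)
  then show ?case
    by (intro subsetI CollectI grounded_intro) (fastforce simp: holds_simps dest: grounded_holds)+
next
  case (Fix \<eta> X \<phi>)
  let ?\<sigma> = "\<sigma>(X := inst \<sigma> (Fix \<eta> X \<phi>))"
  have occ: "(\<phi>, ?\<sigma>) \<in> occs \<rho>"
    using Fix.prems(1) by (rule occs_Fix)
  show ?case
  proof (cases \<eta>)
    case Mu
    let ?S = "{w. grounded E w (inst \<sigma> (Fix \<eta> X \<phi>))}"
    have "mu_bound ?\<sigma> \<phi>"
      using Fix.prems(2) Mu by (auto simp: mu_bound_def)
    moreover have "(V(X := ?S)) Y \<inter> worlds M \<subseteq> {w. grounded E w (?\<sigma> Y)}" if "Y \<in> fv \<phi>" for Y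
      using Fix.prems(3)[of Y] that by auto
    ultimately have sub: "sem M (V(X := ?S)) \<phi> \<subseteq> {w. grounded E w (inst ?\<sigma> \<phi>)}"
      using Fix.IH[OF occ] by blast
    have unf: "inst ?\<sigma> \<phi> = unfold_fp \<eta> X (inst (\<sigma>(X := Var X)) \<phi>)"
      using occs_unfold[OF Fix.prems(1) closed[OF assms(2)]] by simp
    have "grounded E w (inst \<sigma> (Fix \<eta> X \<phi>))" if "grounded E w (inst ?\<sigma> \<phi>)" for w
    proof (rule grounded_intro)
      show "holds M w (inst \<sigma> (Fix \<eta> X \<phi>))"
        using that holds_unfold[of \<eta> X "inst (\<sigma>(X := Var X)) \<phi>", OF _ model]
          occs_inst_closed[OF Fix.prems(1) closed[OF assms(2)]]
        unfolding unf grounded_def by simp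
      show "justified E w (inst \<sigma> (Fix \<eta> X \<phi>))"
        using that unfolding unf by simp
    qed
    with sub have "sem M (V(X := ?S)) \<phi> \<subseteq> ?S"
      by blast
    then have "lfp (\<lambda>S. sem M (V(X := S)) \<phi>) \<subseteq> ?S"
      by (rule lfp_lowerbound)
    then show ?thesis
      using Mu by simp
  next
    case Nu
    then have cl: "fv (Fix \<eta> X \<phi>) = {}"
      using mu_bound_Nu_closed Fix.prems(1,2) assms(2) by blast
    then show ?thesis
      using sem_closed[OF cl, of M V] inst_closed[OF cl] Nu_notin_dfr Nu
      by (auto simp: grounded_def)
  qed
qed (auto simp: mu_bound_def)

lemma holds_grounded:
  assumes "(\<chi>, \<sigma>) \<in> occs \<rho>" "\<rho> \<in> {\<rho>0, \<rho>1}" "mu_bound \<sigma> \<chi>"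
    and "\<And>X w. X \<in> fv \<chi> \<Longrightarrow> holds M w (\<sigma> X) \<Longrightarrow> grounded E w (\<sigma> X)"
    and "holds M w (inst \<sigma> \<chi>)"
  shows "grounded E w (inst \<sigma> \<chi>)"
proof -
  have "sem M (\<lambda>X. sem M (\<lambda>_. {}) (\<sigma> X)) \<chi> \<subseteq> {w. grounded E w (inst \<sigma> \<chi>)}"
    by (rule sem_grounded[OF assms(1-3)]) (use assms(4) in \<open>auto simp: holds_def\<close>)
  moreover have "sem M (\<lambda>_. {}) (inst \<sigma> \<chi>) = sem M (\<lambda>X. sem M (\<lambda>_. {}) (\<sigma> X)) \<chi>"
    by (rule sem_inst[OF _ model]) (use occs_closed[OF assms(1) closed[OF assms(2)]] in blast)
  ultimately show ?thesis
    using assms(5) unfolding holds_def by blast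
qed

text \<open>Discharges the hypothesis on variables in \<open>holds_grounded\<close>: the free
  variables of a binding formula belong to binders further out, which the induction along the path
  from the root treats first.\<close>

lemma binding_grounded:
  assumes "(\<chi>, \<sigma>) \<in> occs \<rho>" "\<rho> \<in> {\<rho>0, \<rho>1}" "X \<in> fv \<chi>" "\<sigma> X = Fix Mu X \<psi>" "holds M w (\<sigma> X)"
  shows "grounded E w (\<sigma> X)"
  using assms(1,3-)
proof (induction \<chi> \<sigma> arbitrary: X \<psi> w rule: occs.induct)
  case occs_root
  then show ?case
    using closed[OF assms(2)] by simp
next
  case (occs_Fix \<eta> Y \<phi> \<sigma>)
  let ?\<sigma> = "\<sigma>(Y := inst \<sigma> (Fix \<eta> Y \<phi>))"
  show ?case
  proof (cases "X = Y")
    case False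
    then show ?thesis
      using occs_Fix.IH[of X] occs_Fix.prems by auto
  next
    case True
    with occs_Fix.prems have Mu: "\<eta> = Mu"
      by simp
    have Y: "Y \<in> fv \<phi>"
      using binder_occurs[OF occs_Fix.hyps assms(2)] .
    have occ: "(\<phi>, ?\<sigma>) \<in> occs \<rho>"
      using occs_Fix.hyps by (rule occs.occs_Fix)
    have mu: "\<exists>\<psi>. \<sigma> Z = Fix Mu Z \<psi>" if Z: "Z \<in> fv (Fix \<eta> Y \<phi>)" for Z
    proof -
      obtain \<eta>' \<phi>' \<tau> where "\<sigma> Z = inst \<tau> (Fix \<eta>' Z \<phi>')"
        using occs_binder[OF occs_Fix.hyps closed[OF assms(2)] Z] by blast
      then show ?thesis
        using occs_same_kind[OF occ closed[OF assms(2)] alt_free[OF assms(2)] Y, of Z] Z Mu by auto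
    qed
    have "grounded E w (inst \<sigma> (Fix \<eta> Y \<phi>))"
    proof (rule holds_grounded[OF occs_Fix.hyps assms(2)])
      show "mu_bound \<sigma> (Fix \<eta> Y \<phi>)"
        using mu by (simp add: mu_bound_def)
      show "grounded E w (\<sigma> Z)" if "Z \<in> fv (Fix \<eta> Y \<phi>)" "holds M w (\<sigma> Z)" for Z w
        using mu[OF that(1)] occs_Fix.IH that by blast
      show "holds M w (inst \<sigma> (Fix \<eta> Y \<phi>))"
        using occs_Fix.prems(3) True by simp
    qed
    then show ?thesis
      using True by simp
  qed
qed auto

text \<open>Here truth in the model becomes well-founded fulfilment: a true deferral enters the
  least fixpoint E.\<close>

lemma holds_dfr_grounded:
  assumes "\<delta> \<in> D" "holds M w \<delta>"
  shows "(w, \<delta>) \<in> E"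
proof -
  obtain \<rho> \<chi> \<sigma> where *: "\<rho> \<in> {\<rho>0, \<rho>1}" "(\<chi>, \<sigma>) \<in> occs \<rho>" "\<delta> = inst \<sigma> \<chi>" "mu_bound \<sigma> \<chi>"
    using assms(1) by (rule dfrE)
  have "grounded E w \<delta>"
    using assms(2) unfolding *(3)
    by (rule holds_grounded[OF *(2,1,4), rotated])
      (use binding_grounded[OF *(2,1)] *(4) in \<open>auto simp: mu_bound_def\<close>)
  then show ?thesis
    using assms(1) by (simp add: grounded_def)
qed

section \<open>Rule applications simulated in the model\<close>

definition sat :: "('p, 'a, 'v) fm set \<Rightarrow> 'w \<Rightarrow> bool" where
  "sat \<Gamma> w \<longleftrightarrow> \<Gamma> \<subseteq> C \<and> w \<in> worlds M \<and> (\<forall>\<phi> \<in> \<Gamma>. holds M w \<phi>)"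

text \<open>The diamond supplies a neighbourhood and the box a world in it, each with a
  justification in S if it is tracked. The index is 0 because the modal rule has a single
  conclusion.\<close>

lemma modal_step:
  assumes "state \<Gamma>" "sat \<Gamma> w" "F \<subseteq> \<Gamma> \<inter> D" "{w} \<times> F \<subseteq> just S" "applicable r \<Gamma>"
  shows "\<exists>u. sat (concl \<Gamma> r ! 0) u \<and> {u} \<times> (\<Union>\<chi> \<in> F. track D \<chi> (r, 0)) \<subseteq> S"
proof -
  obtain a \<phi> \<psi> where r: "r = RDia a \<phi> \<psi>" "Dia a \<phi> \<in> \<Gamma>" "Box a \<psi> \<in> \<Gamma>"
    using assms(1,5) by (rule state_rule)
  have w: "w \<in> worlds M"
    using assms(2) by (simp add: sat_def)
  have "\<exists>U \<in> nbhd M a w. \<forall>u \<in> U. holds M u \<phi> \<and> (Dia a \<phi> \<in> F \<longrightarrow> \<phi> \<in> D \<longrightarrow> (u, \<phi>) \<in> S)"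
  proof (cases "Dia a \<phi> \<in> F")
    case True
    then have "justified S w (Dia a \<phi>)"
      using assms(4) by (auto simp: just_def)
    then show ?thesis
      by (auto simp: grounded_def)
  next
    case False
    have "holds M w (Dia a \<phi>)"
      using r assms(2) by (simp add: sat_def)
    with False show ?thesis
      by (auto simp: holds_simps)
  qed
  then obtain U where U: "U \<in> nbhd M a w"
    "\<And>u. u \<in> U \<Longrightarrow> holds M u \<phi> \<and> (Dia a \<phi> \<in> F \<longrightarrow> \<phi> \<in> D \<longrightarrow> (u, \<phi>) \<in> S)"
    by blast
  have "\<exists>u \<in> U. holds M u \<psi> \<and> (Box a \<psi> \<in> F \<longrightarrow> \<psi> \<in> D \<longrightarrow> (u, \<psi>) \<in> S)"
  proof (cases "Box a \<psi> \<in> F")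
    case True
    then have "justified S w (Box a \<psi>)"
      using assms(4) by (auto simp: just_def)
    then show ?thesis
      using U(1) by (auto simp: grounded_def)
  next
    case False
    have "holds M w (Box a \<psi>)"
      using r assms(2) by (simp add: sat_def)
    with False show ?thesis
      using U(1) by (auto simp: holds_simps)
  qed
  then obtain u where u: "u \<in> U" "holds M u \<psi>" "Box a \<psi> \<in> F \<longrightarrow> \<psi> \<in> D \<longrightarrow> (u, \<psi>) \<in> S"
    by blast
  have uw: "u \<in> worlds M"
    using u(1) U(1) w model by (auto simp: is_model_def)
  have "concl \<Gamma> r ! 0 \<subseteq> C"
    by (rule concl_cl) (use assms r in \<open>auto simp: sat_def\<close>)
  then have "sat (concl \<Gamma> r ! 0) u"
    using uw u U(2)[OF u(1)] global[OF uw] r(1) by (simp add: sat_def)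
  moreover have "{u} \<times> (\<Union>\<chi> \<in> F. track D \<chi> (r, 0)) \<subseteq> S"
    using u(3) U(2)[OF u(1)] r(1) by (auto split: if_splits)
  ultimately show ?thesis
    by blast
qed

text \<open>A tracked principal formula passes to its justification in S, while the other tracked
  formulae stay as they are; hence the union with F.\<close>

lemma local_step:
  assumes "\<not> state \<Gamma>" "sat \<Gamma> w" "F \<subseteq> \<Gamma> \<inter> D" "{w} \<times> F \<subseteq> just S"
  shows "\<exists>r i. \<not> modal r \<and> applicable r \<Gamma> \<and> i < length (concl \<Gamma> r) \<and> sat (concl \<Gamma> r ! i) w \<and>
    {w} \<times> (\<Union>\<chi> \<in> F. track D \<chi> (r, i)) \<subseteq> S \<union> {w} \<times> F"
proof -
  have \<Gamma>: "\<Gamma> \<subseteq> C" "w \<in> worlds M" "\<And>\<phi>. \<phi> \<in> \<Gamma> \<Longrightarrow> holds M w \<phi>"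
    using assms(2) by (auto simp: sat_def)
  have just: "justified S w \<phi>" if "\<phi> \<in> F" for \<phi>
    using assms(4) that by (auto simp: just_def)
  have "Bot \<notin> \<Gamma>"
    using \<Gamma>(3)[of Bot] by (auto simp: holds_def)
  moreover have "\<not> {Atom p, Atom (dual p)} \<subseteq> \<Gamma>" for p
    using \<Gamma>(3)[of "Atom p"] \<Gamma>(3)[of "Atom (dual p)"] model by (auto simp: holds_def is_model_def)
  ultimately consider \<phi> \<psi> where "And \<phi> \<psi> \<in> \<Gamma>" | \<phi> \<psi> where "Or \<phi> \<psi> \<in> \<Gamma>" | \<eta> X \<phi> where "Fix \<eta> X \<phi> \<in> \<Gamma>"
    using assms(1) \<Gamma>(1) unfolding formal_state_def by blast
  then show ?thesis
  proof cases
    case 1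
    then have "sat (concl \<Gamma> (RAnd \<phi> \<psi>) ! 0) w"
      using \<Gamma> \<Gamma>(3)[OF 1] by (auto simp: sat_def holds_simps dest: cl_steps)
    moreover have "{w} \<times> (\<Union>\<chi> \<in> F. track D \<chi> (RAnd \<phi> \<psi>, 0)) \<subseteq> S \<union> {w} \<times> F"
      using just[of "And \<phi> \<psi>"] by (auto simp: grounded_def)
    ultimately show ?thesis
      using 1 by (intro exI[of _ "RAnd \<phi> \<psi>"] exI[of _ 0]) (auto simp: applicable_def modal_def)
  next
    case 2
    \<comment> \<open>The model selects the disjunct: a true one, and a grounded one if the
      disjunction is tracked.\<close>
    have "\<exists>\<gamma> \<in> {\<phi>, \<psi>}. holds M w \<gamma> \<and> (Or \<phi> \<psi> \<in> F \<longrightarrow> grounded S w \<gamma>)"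
      using just[of "Or \<phi> \<psi>"] \<Gamma>(3)[OF 2]
      by (cases "Or \<phi> \<psi> \<in> F") (auto simp: holds_simps dest: grounded_holds)
    then obtain i \<gamma> where i: "(i = 0 \<and> \<gamma> = \<phi>) \<or> (i = Suc 0 \<and> \<gamma> = \<psi>)"
      and \<gamma>: "holds M w \<gamma>" "Or \<phi> \<psi> \<in> F \<Longrightarrow> grounded S w \<gamma>"
      by blast
    have "\<gamma> \<in> C"
      using i 2 \<Gamma>(1) cl_steps(3,4) by blast
    then have "sat (concl \<Gamma> (ROr \<phi> \<psi>) ! i) w"
      using \<Gamma> \<gamma>(1) i by (auto simp: sat_def)
    moreover have "{w} \<times> (\<Union>\<chi> \<in> F. track D \<chi> (ROr \<phi> \<psi>, i)) \<subseteq> S \<union> {w} \<times> F"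
      using i \<gamma>(2) by (auto simp: grounded_def split: if_splits)
    ultimately show ?thesis
      using 2 i by (intro exI[of _ "ROr \<phi> \<psi>"] exI[of _ i]) (auto simp: applicable_def modal_def)
  next
    case 3
    have "fv (Fix \<eta> X \<phi>) = {}"
      using 3 \<Gamma>(1) by (intro cl_closed) blast
    then have "holds M w (unfold_fp \<eta> X \<phi>)"
      using \<Gamma>(3)[OF 3] by (subst holds_unfold[OF _ model])
    then have "sat (concl \<Gamma> (RFix \<eta> X \<phi>) ! 0) w"
      using \<Gamma> 3 by (auto simp: sat_def dest: cl_steps)
    moreover have "{w} \<times> (\<Union>\<chi> \<in> F. track D \<chi> (RFix \<eta> X \<phi>, 0)) \<subseteq> S \<union> {w} \<times> F"
      using just[of "Fix \<eta> X \<phi>"] by (auto simp: grounded_def)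
    ultimately show ?thesis
      using 3 by (intro exI[of _ "RFix \<eta> X \<phi>"] exI[of _ 0]) (auto simp: applicable_def modal_def)
  qed
qed

section \<open>The focus game\<close>

type_synonym ('x, 'y, 'z) fnode = "('x, 'y, 'z) fm set \<times> ('x, 'y, 'z) fm set"

text \<open>The reset takes effect in the successor: after an empty focus come all deferrals of the
  next label, so every trace running at that time is captured.\<close>

definition nxt :: "('p, 'a, 'v) fnode \<Rightarrow> ('p, 'a, 'v) step \<Rightarrow> ('p, 'a, 'v) fnode" where
  "nxt x s = (let \<Gamma> = concl (fst x) (fst s) ! snd s in
     (\<Gamma>, if snd x = {} then \<Gamma> \<inter> D else \<Union>\<chi> \<in> snd x. track D \<chi> s))"

definition legal :: "('p, 'a, 'v) fm set \<Rightarrow> ('p, 'a, 'v) step \<Rightarrow> bool" where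
  "legal \<Gamma> s \<longleftrightarrow> applicable (fst s) \<Gamma> \<and> snd s < length (concl \<Gamma> (fst s)) \<and>
     (modal (fst s) \<longleftrightarrow> state \<Gamma>)"

text \<open>In game terms, the opponent moves at states, while elsewhere the rule and the disjunct
  are chosen by the player who wants to empty the focus.\<close>

definition controlled :: "('p, 'a, 'v) fnode set \<Rightarrow> ('p, 'a, 'v) fnode \<Rightarrow> bool" where
  "controlled R x \<longleftrightarrow> (if state (fst x) then \<forall>s. legal (fst x) s \<longrightarrow> nxt x s \<in> R
     else \<exists>s. legal (fst x) s \<and> nxt x s \<in> R)"

text \<open>\<open>attr n\<close> consists of the nodes from which the focus can be emptied within \<open>n\<close> steps.\<close>

primrec attr :: "nat \<Rightarrow> ('p, 'a, 'v) fnode set" where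
  "attr 0 = {x. snd x = {} \<and> (\<exists>w. sat (fst x) w)}"
| "attr (Suc n) = attr n \<union>
     {x. fst x \<subseteq> C \<and> snd x \<subseteq> fst x \<inter> D \<and> snd x \<noteq> {} \<and> controlled (attr n) x}"

definition R :: "('p, 'a, 'v) fnode set" where
  "R = (\<Union>n. attr n)"

lemma attr_mono: "m \<le> n \<Longrightarrow> attr m \<subseteq> attr n"
  by (rule lift_Suc_mono_le) auto

lemma R_cl: "x \<in> R \<Longrightarrow> fst x \<subseteq> C \<and> snd x \<subseteq> fst x \<inter> D"
proof -
  have "x \<in> attr n \<Longrightarrow> fst x \<subseteq> C \<and> snd x \<subseteq> fst x \<inter> D" for n
    by (induction n) (auto simp: sat_def)
  then show "x \<in> R \<Longrightarrow> ?thesis"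
    by (auto simp: R_def)
qed

lemma finite_R: "finite R"
proof (rule finite_subset)
  show "R \<subseteq> Pow C \<times> Pow C"
    using R_cl by fastforce
qed (simp add: finite_cl)

text \<open>As R is finite, the increasing stages exhaust it after finitely many steps, so a union
  over the natural numbers is already closed under controlled steps.\<close>

lemma R_step:
  assumes "fst x \<subseteq> C" "snd x \<subseteq> fst x \<inter> D" "snd x \<noteq> {}" "controlled R x"
  shows "x \<in> R"
proof -
  have "\<exists>n. Y \<subseteq> attr n" if "Y \<subseteq> R" for Y
  proof -
    have "finite Y"
      using that finite_R finite_subset by blast
    then show ?thesis
      using that
    proof induction
      case (insert y Y)
      then obtain m n where "Y \<subseteq> attr m" "y \<in> attr n"
        by (auto simp: R_def)
      then have "insert y Y \<subseteq> attr (max m n)"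
        using attr_mono[of m "max m n"] attr_mono[of n "max m n"] by auto
      then show ?case by blast
    qed simp
  qed
  then obtain n where "R \<subseteq> attr n"
    by blast
  then have "controlled (attr n) x"
    using assms(4) unfolding controlled_def by (auto split: if_splits)
  then have "x \<in> attr (Suc n)"
    using assms by simp
  then show ?thesis
    unfolding R_def by blast
qed

text \<open>The invariant for the stages of E: justification up to a stage suffices to win the focus
  game.\<close>

definition discharging :: "('w \<times> ('p, 'a, 'v) fm) set \<Rightarrow> bool" where
  "discharging S \<longleftrightarrow> (\<forall>w \<Gamma> F. sat \<Gamma> w \<longrightarrow> F \<subseteq> \<Gamma> \<inter> D \<longrightarrow> {w} \<times> F \<subseteq> S \<longrightarrow> (\<Gamma>, F) \<in> R)"

lemma sat_R: "sat \<Gamma> w \<Longrightarrow> (\<Gamma>, {}) \<in> R"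
  unfolding R_def by (auto intro!: exI[of _ 0])

lemma legal_track:
  assumes "legal \<Gamma> (r, i)" "F \<subseteq> \<Gamma> \<inter> D"
  shows "(\<Union>\<chi> \<in> F. track D \<chi> (r, i)) \<subseteq> concl \<Gamma> r ! i \<inter> D"
  by (intro UN_least track_concl) (use assms in \<open>auto simp: legal_def\<close>)

text \<open>Local expansion is handled by induction on the weight. Tracked formulae may drop into S
  meanwhile, and \<open>S \<subseteq> just S\<close> keeps them admissible. A modal step moves the
  whole focus into S, where the hypothesis on S applies.\<close>

lemma discharging_just:
  assumes "S \<subseteq> just S" "discharging S"
  shows "discharging (just S)"
proof -
  have "(\<Gamma>, F) \<in> R" if "sat \<Gamma> w" "F \<subseteq> \<Gamma> \<inter> D" "{w} \<times> F \<subseteq> just S" for \<Gamma> F w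
    using that
  proof (induction "weight \<Gamma>" arbitrary: \<Gamma> F rule: less_induct)
    case less
    have \<Gamma>: "\<Gamma> \<subseteq> C"
      using less.prems(1) by (simp add: sat_def)
    show ?case
    proof (cases "F = {}")
      case True
      then show ?thesis
        using sat_R less.prems(1) by blast
    next
      case F: False
      have "controlled R (\<Gamma>, F)"
      proof (cases "state \<Gamma>")
        case True
        have "nxt (\<Gamma>, F) s \<in> R" if s: "legal \<Gamma> s" for s
        proof -
          obtain r i where ri: "s = (r, i)"
            by (cases s)
          have r: "applicable r \<Gamma>" "i < length (concl \<Gamma> r)"
            using s ri by (auto simp: legal_def)
          have "i = 0"
            using state_rule[OF True r(1)] r(2) by force
          moreover obtain u where "sat (concl \<Gamma> r ! 0) u"
            "{u} \<times> (\<Union>\<chi> \<in> F. track D \<chi> (r, 0)) \<subseteq> S"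
            using modal_step[OF True less.prems r(1)] by blast
          ultimately show ?thesis
            using assms(2) F legal_track[OF s[unfolded ri] less.prems(2)]
            unfolding ri nxt_def discharging_def by (simp add: Let_def)
        qed
        then show ?thesis
          using True by (simp add: controlled_def)
      next
        case False
        obtain r i where r: "\<not> modal r" "applicable r \<Gamma>" "i < length (concl \<Gamma> r)"
          and step: "sat (concl \<Gamma> r ! i) w" "{w} \<times> (\<Union>\<chi> \<in> F. track D \<chi> (r, i)) \<subseteq> S \<union> {w} \<times> F"
          using local_step[OF False less.prems] by blast
        have legal: "legal \<Gamma> (r, i)"
          using r False by (simp add: legal_def)
        have "{w} \<times> (\<Union>\<chi> \<in> F. track D \<chi> (r, i)) \<subseteq> just S"
          using step(2) assms(1) less.prems(3) by blast
        then have "nxt (\<Gamma>, F) (r, i) \<in> R"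
          using less.hyps[OF concl_weight[OF \<Gamma> r] step(1) legal_track[OF legal less.prems(2)]] F
          by (simp add: nxt_def Let_def)
        then show ?thesis
          using False legal unfolding controlled_def by auto
      qed
      then show ?thesis
        using R_step[of "(\<Gamma>, F)"] \<Gamma> F less.prems(2) by simp
    qed
  qed
  then show ?thesis
    by (auto simp: discharging_def)
qed

text \<open>Transfinite induction along the construction of the least fixpoint. At limit stages the
  finite focus is contained in a single earlier stage because the stages form a chain.\<close>

lemma discharging_E: "discharging E"
proof -
  \<comment> \<open>The inclusion is carried along because \<open>discharging_just\<close> requires
    it at every stage.\<close>
  have "E \<subseteq> just E \<and> discharging E"
    unfolding E_def lfp_eq_fixp[OF mono_just]
  proof (induction rule: fixp_induct)
    show "ccpo.admissible Sup (\<le>) (\<lambda>S. S \<subseteq> just S \<and> discharging S)"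
    proof (rule ccpo.admissibleI)
      fix A :: "('w \<times> ('p, 'a, 'v) fm) set set"
      assume A: "Complete_Partial_Order.chain (\<le>) A" "A \<noteq> {}"
        "\<forall>S \<in> A. S \<subseteq> just S \<and> discharging S"
      have "\<Union>A \<subseteq> just (\<Union>A)"
        using A(3) monoD[OF mono_just] by blast
      moreover have "discharging (\<Union>A)"
        unfolding discharging_def
      proof (intro allI impI)
        fix w \<Gamma> F
        assume *: "sat \<Gamma> w" "F \<subseteq> \<Gamma> \<inter> D" "{w} \<times> F \<subseteq> \<Union>A"
        have "\<Gamma> \<subseteq> C"
          using *(1) by (simp add: sat_def)
        then have fin: "finite ({w} \<times> F)"
          using *(2) finite_subset[OF _ finite_cl, of F] by auto
        have chain: "subset.chain UNIV A"
          using A(1) by (auto simp: subset.chain_def Complete_Partial_Order.chain_def)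
        obtain S where S: "S \<in> A" "{w} \<times> F \<subseteq> S"
          by (rule finite_subset_Union_chain[OF fin *(3) A(2) chain])
        then have "discharging S"
          using A(3) by blast
        then show "(\<Gamma>, F) \<in> R"
          using *(1,2) S(2) unfolding discharging_def by blast
      qed
      ultimately show "\<Union>A \<subseteq> just (\<Union>A) \<and> discharging (\<Union>A)" ..
    qed
    show "Sup {} \<subseteq> just (Sup {}) \<and> discharging (Sup {})"
      by (auto simp: discharging_def intro: sat_R)
  qed (use mono_just discharging_just in \<open>auto simp: monotone_def mono_def\<close>)
  then show ?thesis ..
qed

text \<open>All true deferrals lie in E, so a satisfiable label may be focused on all of its
  deferrals at once.\<close>

lemma sat_refocus: "sat \<Gamma> w \<Longrightarrow> (\<Gamma>, \<Gamma> \<inter> D) \<in> R"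
  using discharging_E holds_dfr_grounded unfolding discharging_def sat_def by blast

section \<open>A strategy with decreasing age\<close>

definition age :: "('p, 'a, 'v) fnode \<Rightarrow> nat" where
  "age x = (LEAST n. x \<in> attr n)"

definition descending :: "('p, 'a, 'v) fnode \<Rightarrow> ('p, 'a, 'v) step \<Rightarrow> bool" where
  "descending x s \<longleftrightarrow> nxt x s \<in> R \<and> (snd x \<noteq> {} \<longrightarrow> age (nxt x s) < age x)"

text \<open>With nonempty focus, minimality of the age puts the controlled successors at an earlier
  stage. With empty focus no decrease is demanded: the label is satisfiable, hence so is that of the
  successor, which can be refocused.\<close>

lemma descending_steps:
  assumes "x \<in> R"
  shows "if state (fst x) then \<forall>s. legal (fst x) s \<longrightarrow> descending x s
    else \<exists>s. legal (fst x) s \<and> descending x s"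
proof (cases "snd x = {}")
  case True
  \<comment> \<open>Later stages only add nodes with nonempty focus.\<close>
  have "x \<in> attr n \<Longrightarrow> snd x = {} \<Longrightarrow> x \<in> attr 0" for n
    by (induction n) auto
  then obtain w where w: "sat (fst x) w"
    using assms True unfolding R_def by auto
  show ?thesis
  proof (cases "state (fst x)")
    case state: True
    have "descending x s" if s: "legal (fst x) s" for s
    proof -
      obtain r i where ri: "s = (r, i)"
        by (cases s)
      have r: "applicable r (fst x)" "i < length (concl (fst x) r)"
        using s ri by (auto simp: legal_def)
      have "i = 0"
        using state_rule[OF state r(1)] r(2) by force
      then show ?thesis
        using modal_step[OF state w _ _ r(1), of "{}" "{}"] sat_refocus True ri
        by (auto simp: descending_def nxt_def Let_def)
    qed
    then show ?thesis
      using state by simp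
  next
    case False
    obtain r i where "\<not> modal r" "applicable r (fst x)" "i < length (concl (fst x) r)"
      "sat (concl (fst x) r ! i) w"
      using local_step[OF False w, of "{}" "{}"] by auto
    then have "legal (fst x) (r, i) \<and> descending x (r, i)"
      using False True sat_refocus by (auto simp: legal_def descending_def nxt_def Let_def)
    then show ?thesis
      using False by auto
  qed
next
  case False
  have x: "x \<in> attr (age x)"
    using assms unfolding R_def age_def by (auto intro: LeastI)
  obtain n where n: "age x = Suc n"
    using x False by (cases "age x") auto
  have "x \<notin> attr n"
    using not_less_Least[of n "\<lambda>n. x \<in> attr n"] n unfolding age_def by simp
  then have ctrl: "controlled (attr n) x"
    using x n by simp
  have "descending x s" if "nxt x s \<in> attr n" for s
    using that n Least_le[of "\<lambda>n. nxt x s \<in> attr n" n]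
    unfolding descending_def R_def age_def by auto
  with ctrl show ?thesis
    unfolding controlled_def by (auto split: if_splits)
qed

text \<open>Outside states one move is fixed, since a pre-tableau demands exactly one outgoing edge
  there.\<close>

definition moves :: "('p, 'a, 'v) fnode \<Rightarrow> ('p, 'a, 'v) step set" where
  "moves x = (if state (fst x) then {s. legal (fst x) s}
     else {SOME s. legal (fst x) s \<and> descending x s})"

lemma moves:
  assumes "x \<in> R" "s \<in> moves x"
  shows "legal (fst x) s" "descending x s"
proof -
  have "legal (fst x) s \<and> descending x s"
  proof (cases "state (fst x)")
    case True
    then show ?thesis
      using assms(2) descending_steps[OF assms(1)] by (cases s) (simp add: moves_def)
  next
    case False
    then have "\<exists>s. legal (fst x) s \<and> descending x s"
      using descending_steps[OF assms(1)] by simp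
    from someI_ex[OF this] show ?thesis
      using assms(2) False by (simp add: moves_def)
  qed
  then show "legal (fst x) s" "descending x s"
    by auto
qed

text \<open>If the focus is ever empty, the reset after it captures the trace, which keeps the focus
  nonempty from then on. Otherwise it is nonempty from the start. Either way the ages would decrease
  forever.\<close>

lemma no_infinite_focus:
  assumes step: "\<And>i. x i \<in> R" "\<And>i. s i \<in> moves (x i)" "\<And>i. x (Suc i) = nxt (x i) (s i)"
    and \<phi>0: "\<phi> 0 \<in> fst (x 0) \<inter> D"
    and tr: "\<And>i. \<phi> (Suc i) \<in> track D (\<phi> i) (s i)"
  shows False
proof -
  have legal: "legal (fst (x i)) (s i)" "descending (x i) (s i)" for i
    using moves[OF step(1,2)] by auto
  have \<phi>: "\<phi> i \<in> fst (x i) \<inter> D" for i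
  proof (induction i)
    case (Suc i)
    have "track D (\<phi> i) (s i) \<subseteq> concl (fst (x i)) (fst (s i)) ! snd (s i) \<inter> D"
      using track_concl[of "\<phi> i" "fst (x i)" "fst (s i)" "snd (s i)"] legal(1)[of i] Suc
      by (simp add: legal_def)
    then show ?case
      using tr[of i] step(3)[of i] by (auto simp: nxt_def Let_def)
  qed (use \<phi>0 in simp)
  have "\<exists>k. \<forall>j \<ge> k. snd (x j) \<noteq> {}"
  proof (cases "\<exists>k. snd (x k) = {}")
    case True
    then obtain k where k: "snd (x k) = {}" by blast
    have "\<phi> j \<in> snd (x j)" if "j \<ge> Suc k" for j
      using that
    proof (induction j rule: dec_induct)
      case base
      then show ?case
        using \<phi>[of "Suc k"] k step(3)[of k] by (simp add: nxt_def Let_def)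
    next
      case (step n)
      then show ?case
        using tr[of n] assms(3)[of n] by (auto simp: nxt_def Let_def)
    qed
    then show ?thesis by blast
  qed blast
  then obtain k where k: "\<And>j. j \<ge> k \<Longrightarrow> snd (x j) \<noteq> {}" by blast
  have "age (x (Suc (k + j))) < age (x (k + j))" for j
    using legal(2)[of "k + j"] k[of "k + j"] step(3)[of "k + j"] by (simp add: descending_def)
  then have "\<exists>g. \<forall>j. (g (Suc j), g j) \<in> less_than"
    by (intro exI[of _ "\<lambda>j. age (x (k + j))"]) simp
  then show False
    using wf_iff_no_infinite_down_chain[THEN iffD1, OF wf_less_than] by blast
qed

section \<open>The tableau given by the strategy\<close>

lemma tableau_exists:
  assumes "sat {\<rho>0, \<rho>1} w"
  shows "\<exists>T. tableau_for \<rho>0 \<rho>1 T"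
proof -
  \<comment> \<open>Graph nodes are natural numbers, so the finite set R is numbered
    injectively.\<close>
  obtain f :: "('p, 'a, 'v) fnode \<Rightarrow> nat" where inj: "inj_on f R"
    using finite_imp_inj_to_nat_seg[OF finite_R] by blast
  define T where "T = \<lparr>nodes = f ` R, edges = {(f x, s, f (nxt x s)) | x s. x \<in> R \<and> s \<in> moves x},
    label = (\<lambda>v. fst (inv_into R f v))\<rparr>"
  have lab: "label T (f x) = fst x" if "x \<in> R" for x
    using that inj by (simp add: T_def inv_into_f_f)
  have nxt: "nxt x s \<in> R" if "x \<in> R" "s \<in> moves x" for x s
    using moves[OF that] by (simp add: descending_def)
  have "pre_tableau \<rho>0 \<rho>1 T"
    unfolding pre_tableau_def
  proof (intro conjI ballI allI impI)
    show "finite (nodes T)"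
      using finite_R by (simp add: T_def)
  next
    fix v assume "v \<in> nodes T"
    then obtain x where "x \<in> R" "v = f x"
      by (auto simp: T_def)
    then show "label T v \<subseteq> C"
      using lab R_cl by simp
  next
    fix v r i u assume "(v, (r, i), u) \<in> edges T"
    then obtain x where x: "x \<in> R" "(r, i) \<in> moves x" "v = f x" "u = f (nxt x (r, i))"
      by (auto simp: T_def)
    have "legal (fst x) (r, i)"
      using moves(1)[OF x(1,2)] .
    then show "v \<in> nodes T" "u \<in> nodes T" "applicable r (label T v)"
      "i < length (concl (label T v) r)" "label T u = concl (label T v) r ! i"
      using x nxt[OF x(1,2)] lab by (auto simp: T_def legal_def nxt_def Let_def)
  next
    fix v r assume v: "v \<in> nodes T" "state (label T v)" "applicable r (label T v)"
    then obtain x where x: "x \<in> R" "v = f x"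
      by (auto simp: T_def)
    then have st: "state (fst x)" "applicable r (fst x)"
      using v lab by auto
    then have "(r, 0) \<in> moves x"
      using state_rule[OF st] by (fastforce simp: moves_def legal_def modal_def)
    then have "(v, (r, 0), f (nxt x (r, 0))) \<in> edges T"
      using x by (auto simp: T_def simp del: split_paired_Ex)
    then show "\<exists>i u. (v, (r, i), u) \<in> edges T" by blast
  next
    fix v assume v: "v \<in> nodes T" "\<not> state (label T v)"
    then obtain x where x: "x \<in> R" "v = f x"
      by (auto simp: T_def)
    then have st: "\<not> state (fst x)"
      using v lab by auto
    then obtain r i where ri: "moves x = {(r, i)}"
      unfolding moves_def by (metis surj_pair)
    have "\<not> modal r"
      using moves(1)[OF x(1), of "(r, i)"] ri st by (simp add: legal_def)
    have eq: "y = x" if "y \<in> R" "f y = f x" for y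
      using inj that x(1) by (simp add: inj_on_eq_iff)
    have "d \<in> edges T \<and> fst d = v \<longleftrightarrow> d = (v, (r, i), f (nxt x (r, i)))" for d
    proof
      assume "d \<in> edges T \<and> fst d = v"
      then obtain y s where y: "y \<in> R" "s \<in> moves y" "d = (f y, s, f (nxt y s))" "f y = f x"
        unfolding T_def x(2) by auto
      then show "d = (v, (r, i), f (nxt x (r, i)))"
        using eq[OF y(1,4)] ri x(2) by simp
    next
      assume "d = (v, (r, i), f (nxt x (r, i)))"
      then show "d \<in> edges T \<and> fst d = v"
        using x ri by (auto simp: T_def simp del: split_paired_Ex)
    qed
    then have "{e \<in> edges T. fst e = v} = {(v, (r, i), f (nxt x (r, i)))}"
      by blast
    with \<open>\<not> modal r\<close> show "\<exists>r i u. \<not> modal r \<and> {e \<in> edges T. fst e = v} = {(v, (r, i), u)}"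
      by blast
  qed
  moreover have "\<not> infinite_trace D T \<phi>" for \<phi>
  proof
    assume "infinite_trace D T \<phi>"
    then obtain v s where vs: "\<And>i. (v i, s i, v (Suc i)) \<in> edges T"
      "\<phi> 0 \<in> label T (v 0) \<inter> D" "\<And>i. \<phi> (Suc i) \<in> track D (\<phi> i) (s i)"
      unfolding infinite_trace_def by blast
    define x where "x i = inv_into R f (v i)" for i
    have "x i \<in> R \<and> s i \<in> moves (x i) \<and> x (Suc i) = nxt (x i) (s i)" for i
    proof -
      obtain y where y: "y \<in> R" "s i \<in> moves y" "v i = f y" "v (Suc i) = f (nxt y (s i))"
        using vs(1)[of i] by (auto simp: T_def)
      then show ?thesis
        using inj nxt[OF y(1,2)] by (simp add: x_def inv_into_f_f)
    qed
    moreover have "\<phi> 0 \<in> fst (x 0) \<inter> D"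
      using vs(2) by (simp add: T_def x_def)
    ultimately show False
      using no_infinite_focus[of x s \<phi>] vs(3) by blast
  qed
  \<comment> \<open>The initial node starts with empty focus, for which satisfiability of the label
    suffices.\<close>
  moreover have "({\<rho>0, \<rho>1}, {}) \<in> R"
    using sat_R[OF assms] .
  then have "\<exists>v \<in> nodes T. \<rho>1 \<in> label T v \<and> \<rho>0 \<in> label T v"
    using lab by (intro bexI[of _ "f ({\<rho>0, \<rho>1}, {})"]) (auto simp: T_def)
  ultimately show ?thesis
    unfolding tableau_for_def tableau_def by blast
qed

end

section \<open>From tableaux to models\<close>

fun succs :: "('p, 'a, 'v) fm \<Rightarrow> ('p, 'a, 'v) fm set" where
  "succs (And \<phi> \<psi>) = {\<phi>, \<psi>}"
| "succs (Or \<phi> \<psi>) = {\<phi>, \<psi>}"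
| "succs (Dia a \<phi>) = {\<phi>}"
| "succs (Box a \<phi>) = {\<phi>}"
| "succs (Fix \<eta> X \<phi>) = {unfold_fp \<eta> X \<phi>}"
| "succs _ = {}"

text \<open>A set that can replace a formula under a local rule, with the disjunct already chosen;
  \<open>succs\<close> instead collects all candidates, arguments of modalities included.\<close>

inductive expands :: "('p, 'a, 'v) fm \<Rightarrow> ('p, 'a, 'v) fm set \<Rightarrow> bool" where
  "expands (And \<phi> \<psi>) {\<phi>, \<psi>}"
| "expands (Or \<phi> \<psi>) {\<phi>}"
| "expands (Or \<phi> \<psi>) {\<psi>}"
| "expands (Fix \<eta> X \<phi>) {unfold_fp \<eta> X \<phi>}"

inductive_simps expands_simps:
  "expands Bot \<Theta>" "expands Top \<Theta>" "expands (Atom p) \<Theta>" "expands (And \<phi> \<psi>) \<Theta>"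
  "expands (Or \<phi> \<psi>) \<Theta>" "expands (Dia a \<phi>) \<Theta>" "expands (Box a \<phi>) \<Theta>"
  "expands (Fix \<eta> X \<phi>) \<Theta>" "expands (Var X) \<Theta>"

lemma size_subfms: "\<phi> \<in> subfms \<psi> \<Longrightarrow> size \<phi> \<le> size \<psi>"
  by (induction \<psi>) auto

text \<open>Alternation-freeness: the kind of the free fixpoint variables is preserved until a
  closed subformula is reached.\<close>

lemma succs_occs:
  assumes "(\<xi>, \<tau>) \<in> occs \<beta>" "fv \<beta> = {}" "irredundant \<beta>" "alternation_free \<beta>"
    and "Y \<in> fv \<xi>" "\<tau> Y = Fix \<eta> Y \<zeta>" "\<chi> \<in> succs (inst \<tau> \<xi>)"
  shows "\<exists>\<xi>' \<tau>'. (\<xi>', \<tau>') \<in> occs \<beta> \<and> \<chi> = inst \<tau>' \<xi>' \<and> size \<xi>' < size \<beta> \<and>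
    (fv \<xi>' = {} \<or> (\<exists>Z \<in> fv \<xi>'. \<exists>\<zeta>. \<tau>' Z = Fix \<eta> Z \<zeta>))"
proof -
  have sz: "size \<xi>' \<le> size \<beta>" if "(\<xi>', \<tau>') \<in> occs \<beta>" for \<xi>' \<tau>'
    using occs_subfms[OF that] by (rule size_subfms)
  have kind: "\<exists>\<zeta>. \<tau> Z = Fix \<eta> Z \<zeta>" if Z: "Z \<in> fv \<xi>" for Z
  proof -
    obtain \<eta>' \<phi>' \<tau>' where "\<tau> Z = inst \<tau>' (Fix \<eta>' Z \<phi>')"
      using occs_binder[OF assms(1,2) Z] by blast
    then show ?thesis
      using occs_same_kind[OF assms(1,2,4,5) Z assms(6)] by simp
  qed
  have child: ?thesis if "(\<alpha>, \<tau>) \<in> occs \<beta>" "\<chi> = inst \<tau> \<alpha>" "fv \<alpha> \<subseteq> fv \<xi>" "size \<alpha> < size \<xi>" for \<alpha>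
    using that kind sz[OF assms(1)] by (intro exI[of _ \<alpha>] exI[of _ \<tau>]) fastforce
  \<comment> \<open>An unfolding continues at the occurrence of the body, which is smaller than its
    binder and hence than \<beta>.\<close>
  have unfold: ?thesis
    if fx: "(Fix \<eta> X \<phi>, \<theta>) \<in> occs \<beta>" "\<chi> \<in> succs (inst \<theta> (Fix \<eta> X \<phi>))" for X \<phi> \<theta>
  proof -
    let ?\<theta> = "\<theta>(X := inst \<theta> (Fix \<eta> X \<phi>))"
    have "X \<in> fv \<phi>"
      using assms(3) occs_subfms[OF fx(1)] unfolding irredundant_def by blast
    moreover have "?\<theta> X = Fix \<eta> X (inst (\<theta>(X := Var X)) \<phi>)"
      by simp
    moreover have "\<chi> = inst ?\<theta> \<phi>"
      using fx(2) occs_unfold[OF fx(1) assms(2)] by simp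
    ultimately show ?thesis
      using occs_Fix[OF fx(1)] sz[OF fx(1)] by (intro exI[of _ \<phi>] exI[of _ ?\<theta>]) auto
  qed
  show ?thesis
  proof (cases \<xi> rule: fm.exhaust)
    case (And \<alpha> \<beta>')
    then show ?thesis
      using assms(1,7) child[of \<alpha>] child[of \<beta>'] by (auto dest: occs_steps)
  next
    case (Or \<alpha> \<beta>')
    then show ?thesis
      using assms(1,7) child[of \<alpha>] child[of \<beta>'] by (auto dest: occs_steps)
  next
    case (Dia a \<alpha>)
    then show ?thesis
      using assms(1,7) child[of \<alpha>] by (auto dest: occs_steps)
  next
    case (Box a \<alpha>)
    then show ?thesis
      using assms(1,7) child[of \<alpha>] by (auto dest: occs_steps)
  next
    \<comment> \<open>The instance of a variable is its binding formula, so its successor is the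
      unfolding of that formula.\<close>
    case (Var X)
    then obtain \<eta>' \<phi>' \<tau>' where *: "\<tau> X = inst \<tau>' (Fix \<eta>' X \<phi>')" "(Fix \<eta>' X \<phi>', \<tau>') \<in> occs \<beta>"
      using occs_binder[OF assms(1,2), of X] by auto
    then have "\<eta>' = \<eta>"
      using kind[of X] Var by simp
    then show ?thesis
      using * unfold[of X \<phi>' \<tau>'] assms(7) Var by simp
  next
    case (Fix \<eta>' X \<phi>')
    have occ: "(\<phi>', \<tau>(X := inst \<tau> (Fix \<eta>' X \<phi>'))) \<in> occs \<beta>"
      using assms(1) unfolding Fix by (rule occs_Fix)
    have "X \<in> fv \<phi>'"
      using assms(3) occs_subfms[OF assms(1)] Fix unfolding irredundant_def by blast
    then have "\<eta>' = \<eta>"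
      using occs_same_kind[OF occ assms(2,4), of X Y] assms(5,6) Fix by simp
    then show ?thesis
      using unfold[of X \<phi>' \<tau>] assms(1,7) Fix by simp
  qed (use assms(7) in auto)
qed

section \<open>The model read off a tableau\<close>

locale formula_pair_tableau = formula_pair \<rho>0 \<rho>1 for \<rho>0 \<rho>1 :: "('p, 'a, 'v) fm" +
  fixes T :: "('p, 'a, 'v) graph" and e :: "nat \<Rightarrow> 'w"
  assumes tableau: "tableau \<rho>0 \<rho>1 T"
    and inj_e: "inj e"
begin

text \<open>Paths end at the first state met, as they continue only from nodes that are not
  states.\<close>

inductive local_path :: "nat \<Rightarrow> nat \<Rightarrow> bool" where
  refl: "v \<in> nodes T \<Longrightarrow> state (label T v) \<Longrightarrow> local_path v v"
| step: "(v, s, u) \<in> edges T \<Longrightarrow> \<not> state (label T v) \<Longrightarrow> local_path u t \<Longrightarrow> local_path v t"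

definition W :: "nat set" where
  "W = {t. \<exists>v. \<rho>0 \<in> label T v \<and> local_path v t}"

text \<open>A negative literal holds wherever the positive one is not in the label, as the labels of
  states need not decide every atom.\<close>

definition M :: "('w, 'p, 'a) nbhd_model" where
  "M = \<lparr>worlds = e ` W,
    nbhd = (\<lambda>a w. {U. \<exists>t \<in> W. w = e t \<and> (\<exists>\<phi>. Dia a \<phi> \<in> label T t \<and>
      U = {e t' | t'. \<exists>\<psi> i u. (t, (RDia a \<phi> \<psi>, i), u) \<in> edges T \<and> local_path u t'})}),
    interp = (\<lambda>p. case p of
        Pos q \<Rightarrow> e ` {t \<in> W. Atom (Pos q) \<in> label T t}
      | Neg q \<Rightarrow> e ` W - e ` {t \<in> W. Atom (Pos q) \<in> label T t})\<rparr>"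

text \<open>The successor is the smaller element, so that well-foundedness expresses the absence of
  infinite traces.\<close>

definition trace_rel :: "((nat \<times> ('p, 'a, 'v) fm) \<times> nat \<times> ('p, 'a, 'v) fm) set" where
  "trace_rel = {((u, \<chi>'), (v, \<chi>)). \<chi> \<in> label T v \<inter> D \<and> (\<exists>s. (v, s, u) \<in> edges T \<and> \<chi>' \<in> track D \<chi> s)}"

lemma wf_trace_rel: "wf trace_rel"
  unfolding wf_iff_no_infinite_down_chain
proof
  assume "\<exists>g. \<forall>i. (g (Suc i), g i) \<in> trace_rel"
  then obtain g where g: "\<And>i. (g (Suc i), g i) \<in> trace_rel" by blast
  then have "\<exists>s. (fst (g i), s, fst (g (Suc i))) \<in> edges T \<and> snd (g (Suc i)) \<in> track D (snd (g i)) s" for i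
    using g[of i] by (cases "g i"; cases "g (Suc i)") (auto simp: trace_rel_def)
  then obtain s where "\<And>i. (fst (g i), s i, fst (g (Suc i))) \<in> edges T \<and>
      snd (g (Suc i)) \<in> track D (snd (g i)) (s i)"
    by metis
  moreover have "snd (g 0) \<in> label T (fst (g 0)) \<inter> D"
    using g[of 0] by (cases "g 0"; cases "g (Suc 0)") (auto simp: trace_rel_def)
  ultimately have "infinite_trace D T (\<lambda>i. snd (g i))"
    unfolding infinite_trace_def by (intro exI[of _ "\<lambda>i. fst (g i)"] exI[of _ s]) simp
  then show False
    using tableau unfolding tableau_def by blast
qed

lemmas pre = tableau[unfolded tableau_def, THEN conjunct1, unfolded pre_tableau_def, THEN conjunct2]

lemma label_cl: "v \<in> nodes T \<Longrightarrow> label T v \<subseteq> C"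
  using pre[THEN conjunct1] by (rule bspec)

lemma edge:
  assumes "(v, (r, i), u) \<in> edges T"
  shows "v \<in> nodes T" "u \<in> nodes T" "applicable r (label T v)"
    "i < length (concl (label T v) r)" "label T u = concl (label T v) r ! i"
  using pre[THEN conjunct2, THEN conjunct1, rule_format, OF assms] by simp_all

lemma local_edge_ex:
  assumes "v \<in> nodes T" "\<not> state (label T v)"
  shows "\<exists>r i u. \<not> modal r \<and> {d \<in> edges T. fst d = v} = {(v, (r, i), u)}"
  using pre[THEN conjunct2, THEN conjunct2, THEN conjunct2, rule_format, OF assms] .

lemma local_edge:
  assumes "(v, (r, i), u) \<in> edges T" "\<not> state (label T v)"
  shows "\<not> modal r"
proof -
  obtain r' i' u' where *: "\<not> modal r'" "{d \<in> edges T. fst d = v} = {(v, (r', i'), u')}"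
    using local_edge_ex[OF edge(1)[OF assms(1)] assms(2)] by blast
  have "(v, (r, i), u) \<in> {d \<in> edges T. fst d = v}"
    using assms(1) by simp
  then show ?thesis
    using * by simp
qed

lemma modal_edge:
  assumes "v \<in> nodes T" "state (label T v)" "Dia a \<phi> \<in> label T v" "Box a \<psi> \<in> label T v"
  shows "\<exists>i u. (v, (RDia a \<phi> \<psi>, i), u) \<in> edges T"
proof -
  have "applicable (RDia a \<phi> \<psi>) (label T v)"
    using assms(3,4) by (simp add: applicable_def)
  then show ?thesis
    using pre[THEN conjunct2, THEN conjunct2, THEN conjunct1, rule_format, OF assms(1,2)] by blast
qed

lemma modal_edge_label:
  "(v, (RDia a \<phi> \<psi>, i), u) \<in> edges T \<Longrightarrow> label T u = {\<phi>, \<psi>, \<rho>0}"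
  using edge(4,5)[of v "RDia a \<phi> \<psi>" i u] by simp

lemma local_path_state: "local_path v t \<Longrightarrow> t \<in> nodes T \<and> state (label T t)"
  by (induction rule: local_path.induct) auto

lemma local_path_ex: "v \<in> nodes T \<Longrightarrow> \<exists>t. local_path v t"
proof (induction "weight (label T v)" arbitrary: v rule: less_induct)
  case less
  show ?case
  proof (cases "state (label T v)")
    case True
    then show ?thesis
      using less.prems refl by blast
  next
    case False
    then obtain r i u where ed: "(v, (r, i), u) \<in> edges T"
      using local_edge_ex[OF less.prems] by blast
    have "weight (label T u) < weight (label T v)"
      using concl_weight[OF label_cl[OF less.prems] local_edge[OF ed False] edge(3,4)[OF ed]]
        edge(5)[OF ed] by simp
    then show ?thesis
      using less.hyps edge(2)[OF ed] step[OF ed False] by blast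
  qed
qed

lemma edge_expands:
  assumes "(v, s, u) \<in> edges T" "\<not> state (label T v)" "\<phi> \<in> label T v"
  shows "(\<phi> \<in> label T u \<and> track D \<phi> s = {\<phi>}) \<or>
    (\<exists>\<Theta>. expands \<phi> \<Theta> \<and> \<Theta> \<subseteq> label T u \<and> track D \<phi> s = \<Theta> \<inter> D)"
proof -
  obtain r i where s: "s = (r, i)"
    by (cases s)
  have ed: "(v, (r, i), u) \<in> edges T"
    using assms(1) s by simp
  note e = edge(4,5)[OF ed] local_edge[OF ed assms(2)]
  show ?thesis
  proof (cases r)
    case (RAnd \<alpha> \<beta>)
    then show ?thesis
      using e s assms(3) by (cases "\<phi> = And \<alpha> \<beta>") (auto simp: expands_simps)
  next
    case (ROr \<alpha> \<beta>)
    then have i: "i = 0 \<or> i = Suc 0"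
      using e(1) by auto
    show ?thesis
    proof (cases "\<phi> = Or \<alpha> \<beta>")
      case True
      let ?\<gamma> = "if i = 0 then \<alpha> else \<beta>"
      have "expands \<phi> {?\<gamma>}" "{?\<gamma>} \<subseteq> label T u" "track D \<phi> s = {?\<gamma>} \<inter> D"
        using e(2) i s True ROr by (auto simp: expands_simps)
      then show ?thesis by blast
    next
      case False
      then show ?thesis
        using e(2) i s assms(3) ROr by auto
    qed
  next
    case (RFix \<eta> X \<alpha>)
    then show ?thesis
      using e s assms(3) by (cases "\<phi> = Fix \<eta> X \<alpha>") (auto simp: expands_simps)
  qed (use e in \<open>auto simp: modal_def\<close>)
qed

text \<open>Each edge keeps the formula or expands it, and its trace follows. An expansion uses at
  least one edge, whence the transitive closure; a formula that is kept may already sit at the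
  state.\<close>

lemma local_path_expands:
  assumes "local_path v t" "\<phi> \<in> label T v"
  shows "(\<exists>u \<Theta>. expands \<phi> \<Theta> \<and> \<Theta> \<subseteq> label T u \<and> local_path u t \<and>
      (\<phi> \<in> D \<longrightarrow> (\<forall>\<chi> \<in> \<Theta> \<inter> D. ((u, \<chi>), (v, \<phi>)) \<in> trace_rel\<^sup>+))) \<or>
    (\<phi> \<in> label T t \<and> (\<phi> \<in> D \<longrightarrow> ((t, \<phi>), (v, \<phi>)) \<in> trace_rel\<^sup>*))"
  using assms
proof (induction rule: local_path.induct)
  case (step v s u t)
  have tr: "((u, \<chi>), (v, \<phi>)) \<in> trace_rel" if "\<phi> \<in> D" "\<chi> \<in> track D \<phi> s" for \<chi>
    using that step.hyps(1) step.prems by (auto simp: trace_rel_def simp del: split_paired_Ex)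
  consider "\<phi> \<in> label T u" "track D \<phi> s = {\<phi>}"
    | \<Theta> where "expands \<phi> \<Theta>" "\<Theta> \<subseteq> label T u" "track D \<phi> s = \<Theta> \<inter> D"
    using edge_expands[OF step.hyps(1,2) step.prems] by blast
  then show ?case
  proof cases
    case 1
    then have tr: "\<phi> \<in> D \<Longrightarrow> ((u, \<phi>), (v, \<phi>)) \<in> trace_rel"
      using tr by blast
    from step.IH[OF 1(1)] show ?thesis
      by (meson tr rtrancl.rtrancl_into_rtrancl trancl.trancl_into_trancl)
  next
    case 2
    then show ?thesis
      using tr step.hyps(3) by (metis Int_iff trancl.r_into_trancl)
  qed
qed blast

lemma local_path_W: "\<rho>0 \<in> label T v \<Longrightarrow> local_path v t \<Longrightarrow> t \<in> W"
  by (auto simp: W_def)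

lemma modal_edge_W: "(v, (RDia a \<phi> \<psi>, i), u) \<in> edges T \<Longrightarrow> local_path u t \<Longrightarrow> t \<in> W"
  using local_path_W modal_edge_label by blast

lemma is_model_M: "is_model M"
proof -
  have "interp M (dual p) = worlds M - interp M p" for p
    by (cases p) (auto simp: M_def)
  moreover have "interp M p \<subseteq> worlds M" for p
    by (cases p) (auto simp: M_def)
  moreover have "nbhd M a w \<subseteq> Pow (worlds M)" for a w
    using modal_edge_W by (auto simp: M_def)
  ultimately show ?thesis
    by (simp add: is_model_def)
qed

section \<open>Truth of the labels\<close>

text \<open>One layer of the semantics, with successors interpreted by Y. The value
  \<open>UNIV\<close> at variables is a filler that makes upper bounds trivial there; closed
  formulae are never variables.\<close>

fun eval_step :: "(('p, 'a, 'v) fm \<Rightarrow> 'w set) \<Rightarrow> ('p, 'a, 'v) fm \<Rightarrow> 'w set" where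
  "eval_step Y Bot = {}"
| "eval_step Y Top = worlds M"
| "eval_step Y (Atom p) = interp M p"
| "eval_step Y (And \<phi> \<psi>) = Y \<phi> \<inter> Y \<psi>"
| "eval_step Y (Or \<phi> \<psi>) = Y \<phi> \<union> Y \<psi>"
| "eval_step Y (Dia a \<phi>) = {w \<in> worlds M. \<exists>U \<in> nbhd M a w. U \<subseteq> Y \<phi>}"
| "eval_step Y (Box a \<phi>) = {w \<in> worlds M. \<forall>U \<in> nbhd M a w. U \<inter> Y \<phi> \<noteq> {}}"
| "eval_step Y (Var X) = UNIV"
| "eval_step Y (Fix \<eta> X \<phi>) = Y (unfold_fp \<eta> X \<phi>)"

lemma eval_step_mono:
  "(\<And>\<chi>. \<chi> \<in> succs \<phi> \<Longrightarrow> Y \<chi> \<subseteq> Y' \<chi>) \<Longrightarrow> eval_step Y \<phi> \<subseteq> eval_step Y' \<phi>"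
  by (cases \<phi>) (simp_all, blast+)

text \<open>Used in two ways: with \<open>A\<close> for Y it bounds labelled worlds by one semantic
  layer; with \<open>H\<close> it is the step of the induction on traces, for which IH offers the
  descent between deferrals.\<close>

lemma truth_step:
  assumes "local_path v t" "t \<in> W" "\<phi> \<in> label T v"
    and IH: "\<And>u \<chi> t'. \<chi> \<in> succs \<phi> \<Longrightarrow> \<chi> \<in> label T u \<Longrightarrow> local_path u t' \<Longrightarrow> t' \<in> W \<Longrightarrow>
      (\<phi> \<in> D \<Longrightarrow> \<chi> \<in> D \<Longrightarrow> ((u, \<chi>), (v, \<phi>)) \<in> trace_rel\<^sup>+) \<Longrightarrow> e t' \<in> Y \<chi>"
  shows "e t \<in> eval_step Y \<phi>"
proof -
  have t: "t \<in> nodes T" "state (label T t)"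
    using local_path_state[OF assms(1)] by auto
  have et: "e t \<in> worlds M"
    using assms(2) by (simp add: M_def)
  consider (expand) u \<Theta> where "expands \<phi> \<Theta>" "\<Theta> \<subseteq> label T u" "local_path u t"
      "\<phi> \<in> D \<longrightarrow> (\<forall>\<chi> \<in> \<Theta> \<inter> D. ((u, \<chi>), (v, \<phi>)) \<in> trace_rel\<^sup>+)"
    | (keep) "\<phi> \<in> label T t" "\<phi> \<in> D \<longrightarrow> ((t, \<phi>), (v, \<phi>)) \<in> trace_rel\<^sup>*"
    using local_path_expands[OF assms(1,3)] by blast
  then show ?thesis
  proof cases
    case expand
    then have Y: "e t \<in> Y \<chi>" if "\<chi> \<in> \<Theta>" "\<chi> \<in> succs \<phi>" for \<chi>
      using that IH[OF that(2) _ expand(3) assms(2)] by blast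
    from expand(1) show ?thesis
      by cases (use Y in auto)
  next
    case keep
    \<comment> \<open>The conditional treats both principal formulae of the modal rule at once:
      \<phi> is the diamond and \<chi> its argument, or \<phi> is the box.\<close>
    have IH': "e t' \<in> Y \<chi>"
      if "(t, (RDia a \<alpha> \<beta>, i), u) \<in> edges T" "local_path u t'" "\<chi> \<in> {\<alpha>, \<beta>}"
        "\<phi> = (if \<chi> = \<alpha> \<and> \<phi> = Dia a \<alpha> then Dia a \<alpha> else Box a \<beta>)" "\<chi> \<in> succs \<phi>"
      for a \<alpha> \<beta> i u t' \<chi>
    proof (rule IH[OF that(5) _ that(2) modal_edge_W[OF that(1,2)]])
      show "\<chi> \<in> label T u"
        using modal_edge_label[OF that(1)] that(3) by blast
      assume D: "\<phi> \<in> D" "\<chi> \<in> D"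
      then have "\<chi> \<in> track D \<phi> (RDia a \<alpha> \<beta>, i)"
        using that(3-5) by (auto split: if_splits)
      then have "((u, \<chi>), (t, \<phi>)) \<in> trace_rel"
        using that(1) keep(1) D(1) by (auto simp: trace_rel_def simp del: split_paired_Ex track.simps)
      then show "((u, \<chi>), (v, \<phi>)) \<in> trace_rel\<^sup>+"
        using keep(2) D(1) by (simp add: rtrancl_into_trancl2)
    qed
    show ?thesis
    proof (cases \<phi> rule: fm.exhaust)
      case (Atom p)
      then show ?thesis
        using keep(1) t(2) assms(2) inj_e
        by (cases p) (auto simp: M_def formal_state_def inj_eq dest: spec[of _ "Pos _"])
    next
      case (Dia a \<alpha>)
      \<comment> \<open>Without a box for \<open>a\<close> in the label this set is empty; the
        diamond then holds trivially, and there is no box in the label to be falsified.\<close>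
      let ?U = "{e t' | t'. \<exists>\<psi> i u. (t, (RDia a \<alpha> \<psi>, i), u) \<in> edges T \<and> local_path u t'}"
      have "?U \<in> nbhd M a (e t)"
        using keep(1) Dia assms(2) by (auto simp: M_def)
      moreover have "?U \<subseteq> Y \<alpha>"
        using IH'[of a \<alpha>] Dia by auto
      ultimately show ?thesis
        using Dia et by auto
    next
      case (Box a \<beta>)
      have "U \<inter> Y \<beta> \<noteq> {}" if U: "U \<in> nbhd M a (e t)" for U
      proof -
        obtain \<alpha> where \<alpha>: "Dia a \<alpha> \<in> label T t"
          "U = {e t' | t'. \<exists>\<psi> i u. (t, (RDia a \<alpha> \<psi>, i), u) \<in> edges T \<and> local_path u t'}"
          using U inj_e by (auto simp: M_def inj_eq)
        \<comment> \<open>The modal rule pairing this diamond with the box has an edge, and every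
          state below its conclusion lies in U.\<close>
        obtain i u where ed: "(t, (RDia a \<alpha> \<beta>, i), u) \<in> edges T"
          using modal_edge[OF t \<alpha>(1)] keep(1) Box by blast
        obtain t' where t': "local_path u t'"
          using local_path_ex[OF edge(2)[OF ed]] by blast
        have "e t' \<in> Y \<beta>"
          using IH'[OF ed t', of \<beta>] Box by simp
        then show ?thesis
          using \<alpha>(2) ed t' by blast
      qed
      then show ?thesis
        using Box et by auto
    qed (use keep t et in \<open>auto simp: formal_state_def\<close>)
  qed
qed

text \<open>The label is that of any node from which the state is locally reached, since a formula
  broken down on the way need not be in the label of the state.\<close>

definition A :: "('p, 'a, 'v) fm \<Rightarrow> 'w set" where
  "A \<phi> = {e t | t. t \<in> W \<and> (\<exists>v. \<phi> \<in> label T v \<and> local_path v t)}"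

abbreviation H :: "('p, 'a, 'v) fm \<Rightarrow> 'w set" where
  "H \<phi> \<equiv> {w. holds M w \<phi>}"

lemma A_eval_step: "A \<phi> \<subseteq> eval_step A \<phi>"
proof
  fix w assume "w \<in> A \<phi>"
  then obtain t v where "w = e t" "t \<in> W" "\<phi> \<in> label T v" "local_path v t"
    by (auto simp: A_def)
  then show "w \<in> eval_step A \<phi>"
    using truth_step[of v t \<phi> A] by (auto simp: A_def)
qed

lemma eval_step_holds: "fv \<phi> = {} \<Longrightarrow> eval_step H \<phi> \<subseteq> H \<phi>"
proof (cases \<phi>)
  case (Fix \<eta> X \<alpha>)
  assume "fv \<phi> = {}"
  then show ?thesis
    using Fix holds_unfold[of \<eta> X \<alpha> M, OF _ is_model_M] by simp
qed (auto simp: holds_simps, auto simp: holds_def)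

text \<open>The size induction covers closed subformulae only. Open ones enter through their
  occurrences in \<beta>, with variables replaced by the binding formulae.\<close>

lemma A_subset_H:
  assumes "\<rho> \<in> {\<rho>0, \<rho>1}" "\<beta> \<in> subfms \<rho>" "fv \<beta> = {}"
  shows "A \<beta> \<subseteq> H \<beta>"
  using assms(2,3)
proof (induction "size \<beta>" arbitrary: \<beta> rule: less_induct)
  case less
  have sub: "\<xi> \<in> subfms \<rho>" if "\<xi> \<in> subfms \<beta>" for \<xi>
    using subfms_trans[OF that less.prems(1)] .
  have irr: "irredundant \<beta>" and af: "alternation_free \<beta>"
    using irred[OF assms(1)] alt_free[OF assms(1)] sub
    unfolding irredundant_def alternation_free_def by blast+
  have smaller: "A \<xi> \<subseteq> H \<xi>" if "(\<xi>, \<tau>) \<in> occs \<beta>" "size \<xi> < size \<beta>" "fv \<xi> = {}" for \<xi> \<tau>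
    using less.hyps[OF that(2) sub[OF occs_subfms[OF that(1)]] that(3)] .
  obtain \<tau>0 where \<tau>0: "(\<beta>, \<tau>0) \<in> occs \<rho>"
    using subfms_occs[OF less.prems(1) occs_root] by blast
  have root: "(\<beta>, Var) \<in> occs \<beta>"
    by (rule occs_root)
  \<comment> \<open>Occurrences in \<beta> are occurrences in \<rho> with the same instance, so open
    \<mu>-occurrences give deferrals and the trace relation applies to them.\<close>
  have dfr: "inst \<tau> \<xi> \<in> D" if occ: "(\<xi>, \<tau>) \<in> occs \<beta>" and Z: "Z \<in> fv \<xi>" "\<tau> Z = Fix Mu Z \<zeta>"
    for \<xi> \<tau> Z \<zeta>
  proof -
    obtain \<theta> where \<theta>: "(\<xi>, \<theta>) \<in> occs \<rho>" "\<forall>X \<in> fv \<xi>. \<theta> X = \<tau> X"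
      using occs_embed[OF occ \<tau>0 less.prems(2)] by blast
    then have "inst \<theta> \<xi> = inst \<tau> \<xi>"
      by (intro inst_cong) simp
    then show ?thesis
      using dfrI[OF \<theta>(1) assms(1) Z(1)] \<theta>(2) Z by simp
  qed
  have local: ?case if "\<And>\<chi>. \<chi> \<in> succs \<beta> \<Longrightarrow> A \<chi> \<subseteq> H \<chi>"
    using A_eval_step[of \<beta>] eval_step_mono[of \<beta> A H] that eval_step_holds[OF less.prems(2)] by blast
  show ?case
  proof (cases "\<exists>\<eta> X \<phi>. \<beta> = Fix \<eta> X \<phi>")
    case False
    show ?thesis
    proof (rule local)
      fix \<chi> assume "\<chi> \<in> succs \<beta>"
      then have "(\<chi>, Var) \<in> occs \<beta> \<and> size \<chi> < size \<beta> \<and> fv \<chi> = {}"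
        using False root less.prems(2) by (cases \<beta>) (auto dest: occs_steps)
      then show "A \<chi> \<subseteq> H \<chi>"
        using smaller by blast
    qed
  next
    case True
    then obtain \<eta> X \<phi> where \<beta>: "\<beta> = Fix \<eta> X \<phi>" by blast
    have X: "X \<in> fv \<phi>"
      using irr subfms_refl[of \<beta>] \<beta> unfolding irredundant_def by blast
    show ?thesis
    proof (cases \<eta>)
      case Mu
      \<comment> \<open>Induction along traces for instances of open \<mu>-occurrences; closed
        components are left to the size induction.\<close>
      have mu: "e t \<in> H \<delta>"
        if "(\<xi>, \<tau>) \<in> occs \<beta>" "\<delta> = inst \<tau> \<xi>" "Y \<in> fv \<xi>" "\<tau> Y = Fix Mu Y \<zeta>"
          "\<delta> \<in> label T v" "local_path v t" "t \<in> W"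
        for v \<delta> \<xi> \<tau> Y \<zeta> t
        using that
      proof (induction "(v, \<delta>)" arbitrary: v \<delta> \<xi> \<tau> Y \<zeta> t
          rule: wf_induct_rule[OF wf_trancl[OF wf_trace_rel]])
        case (1 v \<delta>)
        note occ = "1.prems"(1)
        have "e t \<in> eval_step H \<delta>"
        proof (rule truth_step[OF "1.prems"(6,7,5)])
          fix u \<chi> t'
          assume \<chi>: "\<chi> \<in> succs \<delta>" "\<chi> \<in> label T u" "local_path u t'" "t' \<in> W"
            and tr: "\<delta> \<in> D \<Longrightarrow> \<chi> \<in> D \<Longrightarrow> ((u, \<chi>), (v, \<delta>)) \<in> trace_rel\<^sup>+"
          obtain \<xi>' \<tau>' where \<xi>': "(\<xi>', \<tau>') \<in> occs \<beta>" "\<chi> = inst \<tau>' \<xi>'" "size \<xi>' < size \<beta>"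
            "fv \<xi>' = {} \<or> (\<exists>Z \<in> fv \<xi>'. \<exists>\<zeta>. \<tau>' Z = Fix Mu Z \<zeta>)"
            using succs_occs[OF occ less.prems(2) irr af "1.prems"(3,4)] \<chi>(1) "1.prems"(2) by blast
          show "e t' \<in> H \<chi>"
          proof (cases "fv \<xi>' = {}")
            case True
            then have "\<chi> = \<xi>'"
              using \<xi>'(2) inst_closed by blast
            then have "e t' \<in> A \<xi>'"
              using \<chi> by (auto simp: A_def)
            then show ?thesis
              using smaller[OF \<xi>'(1,3) True] \<open>\<chi> = \<xi>'\<close> by blast
          next
            case False
            then obtain Z \<zeta>' where Z: "Z \<in> fv \<xi>'" "\<tau>' Z = Fix Mu Z \<zeta>'"
              using \<xi>'(4) by blast
            have "\<chi> \<in> D" "\<delta> \<in> D"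
              using dfr[OF \<xi>'(1) Z] \<xi>'(2) dfr[OF occ "1.prems"(3,4)] "1.prems"(2) by auto
            then show ?thesis
              using "1.hyps"[OF tr \<xi>'(1,2) Z \<chi>(2-4)] by blast
          qed
        qed
        moreover have "fv \<delta> = {}"
          using occs_inst_closed[OF occ less.prems(2)] "1.prems"(2) by simp
        ultimately show ?case
          using eval_step_holds by blast
      qed
      \<comment> \<open>The closed formula \<beta> is not an open occurrence, so it is unfolded
        once; X is free in the body by irredundance.\<close>
      let ?\<tau> = "Var(X := inst Var (Fix Mu X \<phi>))"
      have occ: "(\<phi>, ?\<tau>) \<in> occs \<beta>"
        using root \<beta> Mu by (intro occs_Fix) simp
      have unf: "unfold_fp Mu X \<phi> = inst ?\<tau> \<phi>"
        by (simp add: unfold_fp_def inst_Var del: inst.simps)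
      show ?thesis
      proof (rule local)
        fix \<chi> assume "\<chi> \<in> succs \<beta>"
        then have "\<chi> = inst ?\<tau> \<phi>"
          using \<beta> Mu unf by simp
        then show "A \<chi> \<subseteq> H \<chi>"
          using mu[OF occ _ X] by (auto simp: A_def)
      qed
    next
      case Nu
      \<comment> \<open>A component is either closed and settled by the size induction, or keeps a
        free \<nu>-variable by alternation-freeness.\<close>
      have child: "A (inst \<tau> \<xi>') \<subseteq> sem M V \<xi>'"
        if \<xi>: "(\<xi>, \<tau>) \<in> occs \<beta>" "\<xi> = \<beta> \<or> (\<exists>Y \<in> fv \<xi>. \<exists>\<zeta>. \<tau> Y = Fix Nu Y \<zeta>)"
          "\<And>Y. Y \<in> fv \<xi> \<Longrightarrow> A (\<tau> Y) \<subseteq> V Y"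
          and \<xi>': "(\<xi>', \<tau>) \<in> occs \<beta>" "size \<xi>' < size \<xi>" "fv \<xi>' \<subseteq> fv \<xi>"
          and IH: "\<exists>Y \<in> fv \<xi>'. \<exists>\<zeta>. \<tau> Y = Fix Nu Y \<zeta> \<Longrightarrow> (\<And>Y. Y \<in> fv \<xi>' \<Longrightarrow> A (\<tau> Y) \<subseteq> V Y) \<Longrightarrow>
            A (inst \<tau> \<xi>') \<subseteq> sem M V \<xi>'"
        for \<xi> \<xi>' \<tau> V
      proof (cases "fv \<xi>' = {}")
        case True
        have "size \<xi>' < size \<beta>"
          using \<xi>'(2) size_subfms[OF occs_subfms[OF \<xi>(1)]] by simp
        then show ?thesis
          using smaller[OF \<xi>'(1) _ True] inst_closed[OF True] sem_closed[OF True, of M V] by simp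
      next
        case False
        then obtain Z where Z: "Z \<in> fv \<xi>'"
          by blast
        obtain Y \<zeta> where Y: "Y \<in> fv \<xi>" "\<tau> Y = Fix Nu Y \<zeta>"
          using \<xi>(2) Z \<xi>'(3) less.prems(2) by blast
        obtain \<eta>' \<phi>' \<tau>' where "\<tau> Z = inst \<tau>' (Fix \<eta>' Z \<phi>')"
          using occs_binder[OF \<xi>'(1) less.prems(2) Z] by blast
        then have "\<exists>\<zeta>. \<tau> Z = Fix Nu Z \<zeta>"
          using occs_same_kind[OF \<xi>(1) less.prems(2) af Y(1) _ Y(2), of Z] Z \<xi>'(3) by auto
        then show ?thesis
          using IH Z \<xi>(3) \<xi>'(3) by blast
      qed
      \<comment> \<open>Structural induction, with V any valuation above the labelled worlds of the
        binding formulae, so that binders can extend it.\<close>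
      have nu: "A (inst \<tau> \<xi>) \<subseteq> sem M V \<xi>"
        if "(\<xi>, \<tau>) \<in> occs \<beta>" "\<xi> = \<beta> \<or> (\<exists>Y \<in> fv \<xi>. \<exists>\<zeta>. \<tau> Y = Fix Nu Y \<zeta>)"
          "\<And>Y. Y \<in> fv \<xi> \<Longrightarrow> A (\<tau> Y) \<subseteq> V Y" for \<xi> \<tau> V
        using that
      proof (induction \<xi> arbitrary: \<tau> V)
        case (Fix \<kappa> Z \<xi>)
        let ?\<tau> = "\<tau>(Z := inst \<tau> (Fix \<kappa> Z \<xi>))"
        let ?S = "A (inst \<tau> (Fix \<kappa> Z \<xi>))"
        have occ: "(\<xi>, ?\<tau>) \<in> occs \<beta>"
          using Fix.prems(1) by (rule occs_Fix)
        have Z: "Z \<in> fv \<xi>"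
          using irr occs_subfms[OF Fix.prems(1)] unfolding irredundant_def by blast
        have \<kappa>: "\<kappa> = Nu"
        proof (cases "Fix \<kappa> Z \<xi> = \<beta>")
          case False
          then obtain Y \<zeta> where "Y \<in> fv \<xi>" "Y \<noteq> Z" "\<tau> Y = Fix Nu Y \<zeta>"
            using Fix.prems(2) by auto
          then show ?thesis
            using occs_same_kind[OF occ less.prems(2) af Z, of Y] by simp
        qed (use \<beta> Nu in simp)
        \<comment> \<open>Coinduction: the worlds labelled with the fixpoint formula form a
          post-fixpoint of the body.\<close>
        have "?S \<subseteq> A (unfold_fp \<kappa> Z (inst (\<tau>(Z := Var Z)) \<xi>))"
          using A_eval_step[of "inst \<tau> (Fix \<kappa> Z \<xi>)"] by simp
        also have "\<dots> = A (inst ?\<tau> \<xi>)"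
          using occs_unfold[OF Fix.prems(1) less.prems(2)] by simp
        also have "\<dots> \<subseteq> sem M (V(Z := ?S)) \<xi>"
        proof (rule Fix.IH[OF occ])
          show "\<xi> = \<beta> \<or> (\<exists>Y \<in> fv \<xi>. \<exists>\<zeta>. ?\<tau> Y = Fix Nu Y \<zeta>)"
            using Z \<kappa> by (intro disjI2 bexI[of _ Z]) simp_all
          show "A (?\<tau> Y) \<subseteq> (V(Z := ?S)) Y" if "Y \<in> fv \<xi>" for Y
            using Fix.prems(3)[of Y] that by auto
        qed
        finally have "?S \<subseteq> gfp (\<lambda>S. sem M (V(Z := S)) \<xi>)"
          by (rule gfp_upperbound)
        then show ?case
          using \<kappa> by simp
      next
        case (Var Y)
        have "A (\<tau> Y) \<subseteq> worlds M"
          by (auto simp: A_def M_def)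
        then show ?case
          using Var.prems(3)[of Y] by simp
      next
        case (And \<xi>1 \<xi>2)
        have "A (inst \<tau> \<xi>1) \<subseteq> sem M V \<xi>1"
        proof (rule child[OF And.prems])
          show occ: "(\<xi>1, \<tau>) \<in> occs \<beta>"
            using And.prems(1) by (rule occs_And1)
          assume "\<exists>Y \<in> fv \<xi>1. \<exists>\<zeta>. \<tau> Y = Fix Nu Y \<zeta>" "\<And>Y. Y \<in> fv \<xi>1 \<Longrightarrow> A (\<tau> Y) \<subseteq> V Y"
          then show "A (inst \<tau> \<xi>1) \<subseteq> sem M V \<xi>1"
            using And.IH(1)[OF occ disjI2] by blast
        qed simp_all
        moreover have "A (inst \<tau> \<xi>2) \<subseteq> sem M V \<xi>2"
        proof (rule child[OF And.prems])
          show occ: "(\<xi>2, \<tau>) \<in> occs \<beta>"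
            using And.prems(1) by (rule occs_And2)
          assume "\<exists>Y \<in> fv \<xi>2. \<exists>\<zeta>. \<tau> Y = Fix Nu Y \<zeta>" "\<And>Y. Y \<in> fv \<xi>2 \<Longrightarrow> A (\<tau> Y) \<subseteq> V Y"
          then show "A (inst \<tau> \<xi>2) \<subseteq> sem M V \<xi>2"
            using And.IH(2)[OF occ disjI2] by blast
        qed simp_all
        ultimately show ?case
          using A_eval_step[of "inst \<tau> (And \<xi>1 \<xi>2)"] by auto
      next
        case (Or \<xi>1 \<xi>2)
        have "A (inst \<tau> \<xi>1) \<subseteq> sem M V \<xi>1"
        proof (rule child[OF Or.prems])
          show occ: "(\<xi>1, \<tau>) \<in> occs \<beta>"
            using Or.prems(1) by (rule occs_Or1)
          assume "\<exists>Y \<in> fv \<xi>1. \<exists>\<zeta>. \<tau> Y = Fix Nu Y \<zeta>" "\<And>Y. Y \<in> fv \<xi>1 \<Longrightarrow> A (\<tau> Y) \<subseteq> V Y"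
          then show "A (inst \<tau> \<xi>1) \<subseteq> sem M V \<xi>1"
            using Or.IH(1)[OF occ disjI2] by blast
        qed simp_all
        moreover have "A (inst \<tau> \<xi>2) \<subseteq> sem M V \<xi>2"
        proof (rule child[OF Or.prems])
          show occ: "(\<xi>2, \<tau>) \<in> occs \<beta>"
            using Or.prems(1) by (rule occs_Or2)
          assume "\<exists>Y \<in> fv \<xi>2. \<exists>\<zeta>. \<tau> Y = Fix Nu Y \<zeta>" "\<And>Y. Y \<in> fv \<xi>2 \<Longrightarrow> A (\<tau> Y) \<subseteq> V Y"
          then show "A (inst \<tau> \<xi>2) \<subseteq> sem M V \<xi>2"
            using Or.IH(2)[OF occ disjI2] by blast
        qed simp_all
        ultimately show ?case
          using A_eval_step[of "inst \<tau> (Or \<xi>1 \<xi>2)"] by auto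
      next
        case (Dia a \<xi>1)
        have "A (inst \<tau> \<xi>1) \<subseteq> sem M V \<xi>1"
        proof (rule child[OF Dia.prems])
          show occ: "(\<xi>1, \<tau>) \<in> occs \<beta>"
            using Dia.prems(1) by (rule occs_Dia)
          assume "\<exists>Y \<in> fv \<xi>1. \<exists>\<zeta>. \<tau> Y = Fix Nu Y \<zeta>" "\<And>Y. Y \<in> fv \<xi>1 \<Longrightarrow> A (\<tau> Y) \<subseteq> V Y"
          then show "A (inst \<tau> \<xi>1) \<subseteq> sem M V \<xi>1"
            using Dia.IH[OF occ disjI2] by blast
        qed simp_all
        then have "eval_step A (inst \<tau> (Dia a \<xi>1)) \<subseteq> sem M V (Dia a \<xi>1)"
          by (simp, blast)
        with A_eval_step show ?case
          by (rule subset_trans)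
      next
        case (Box a \<xi>1)
        have "A (inst \<tau> \<xi>1) \<subseteq> sem M V \<xi>1"
        proof (rule child[OF Box.prems])
          show occ: "(\<xi>1, \<tau>) \<in> occs \<beta>"
            using Box.prems(1) by (rule occs_Box)
          assume "\<exists>Y \<in> fv \<xi>1. \<exists>\<zeta>. \<tau> Y = Fix Nu Y \<zeta>" "\<And>Y. Y \<in> fv \<xi>1 \<Longrightarrow> A (\<tau> Y) \<subseteq> V Y"
          then show "A (inst \<tau> \<xi>1) \<subseteq> sem M V \<xi>1"
            using Box.IH[OF occ disjI2] by blast
        qed simp_all
        then have "eval_step A (inst \<tau> (Box a \<xi>1)) \<subseteq> sem M V (Box a \<xi>1)"
          by (simp, blast)
        with A_eval_step show ?case
          by (rule subset_trans)
      next
        case Top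
        show ?case
          using A_eval_step[of Top] by simp
      next
        case Bot
        show ?case
          using A_eval_step[of Bot] by simp
      next
        case (Atom p)
        show ?case
          using A_eval_step[of "Atom p"] by simp
      qed
      have "A (inst Var \<beta>) \<subseteq> sem M (\<lambda>_. {}) \<beta>"
        by (rule nu[OF root]) (use less.prems(2) in auto)
      then show ?thesis
        by (auto simp: inst_Var holds_def)
    qed
  qed
qed

text \<open>Each world lies below a node labelled with \<rho>0, so \<rho>0 holds globally. A state
  below v is a world because \<rho>0 is in the label of v, and it satisfies \<rho>1.\<close>

lemma satisfiable:
  assumes "v \<in> nodes T" "\<rho>1 \<in> label T v" "\<rho>0 \<in> label T v"
  shows "satisfiable_under TYPE('w) \<rho>0 \<rho>1"
proof -
  have A_H: "A \<rho> \<subseteq> H \<rho>" if "\<rho> \<in> {\<rho>0, \<rho>1}" for \<rho>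
    using A_subset_H[OF that subfms_refl closed[OF that]] .
  have "worlds M \<subseteq> A \<rho>0"
    by (auto simp: A_def W_def M_def)
  then have "\<forall>w \<in> worlds M. holds M w \<rho>0"
    using A_H[of \<rho>0] by auto
  moreover obtain t where t: "local_path v t"
    using local_path_ex[OF assms(1)] by blast
  then have "t \<in> W"
    using assms(3) by (rule local_path_W[rotated])
  then have "e t \<in> A \<rho>1" "e t \<in> worlds M"
    using assms(2) t by (auto simp: A_def M_def)
  then have "\<exists>w \<in> worlds M. holds M w \<rho>1"
    using A_H[of \<rho>1] by auto
  ultimately show ?thesis
    unfolding satisfiable_under_def using is_model_M by (intro exI[of _ M] conjI)
qed

end

(* The type 'w is the supply of worlds of the models; models live on arbitrary subsets of it. *)
theorem theorem1:
  fixes \<rho>0 \<rho>1 :: "('p, 'a, 'v) fm"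
  assumes "infinite (UNIV :: 'w set)"
    and "closed_fm \<rho>1" "clean \<rho>1" "irredundant \<rho>1" "guarded \<rho>1" "alternation_free \<rho>1"
    and "closed_fm \<rho>0" "clean \<rho>0" "irredundant \<rho>0" "guarded \<rho>0" "alternation_free \<rho>0"
  shows "(\<exists>T. tableau_for \<rho>0 \<rho>1 T) \<longleftrightarrow> satisfiable_under TYPE('w) \<rho>0 \<rho>1"
proof -
  have pair: "formula_pair \<rho>0 \<rho>1"
    using assms by unfold_locales (auto simp: closed_fm_def)
  \<comment> \<open>Tableau nodes are natural numbers; this injection turns them into
    worlds.\<close>
  obtain e :: "nat \<Rightarrow> 'w" where e: "inj e"
    using infinite_countable_subset[OF assms(1)] by blast
  show ?thesis
  proof
    assume "\<exists>T. tableau_for \<rho>0 \<rho>1 T"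
    then obtain T v where T: "tableau \<rho>0 \<rho>1 T" "v \<in> nodes T" "\<rho>1 \<in> label T v" "\<rho>0 \<in> label T v"
      unfolding tableau_for_def by blast
    interpret formula_pair_tableau \<rho>0 \<rho>1 T e
      using pair T(1) e by (simp add: formula_pair_tableau_def formula_pair_tableau_axioms_def)
    show "satisfiable_under TYPE('w) \<rho>0 \<rho>1"
      using satisfiable[OF T(2-4)] .
  next
    assume "satisfiable_under TYPE('w) \<rho>0 \<rho>1"
    then obtain M :: "('w, 'p, 'a) nbhd_model" and w where M: "is_model M"
      "\<And>w. w \<in> worlds M \<Longrightarrow> holds M w \<rho>0" "w \<in> worlds M" "holds M w \<rho>1"
      unfolding satisfiable_under_def by blast
    interpret formula_pair_model \<rho>0 \<rho>1 M
      using pair M(1,2) by (simp add: formula_pair_model_def formula_pair_model_axioms_def)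
    have "sat {\<rho>0, \<rho>1} w"
      using M(2-4) rho_cl by (simp add: sat_def)
    then show "\<exists>T. tableau_for \<rho>0 \<rho>1 T"
      by (rule tableau_exists)
  qed
qed

end
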